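(* Let $q=2^{2e+1}$ with $e\ge 1$. The power graph of the Suzuki group $\mathrm{Sz}(q)$ is a chordal graph if and only if each of the numbers $q-1$, $q+\sqrt{2q}+1$ and $q-\sqrt{2q}+1$ is either a prime power or a product of a prime and a prime power.
   Context: The power graph $\mathcal{P}(G)$ of a group $G$ is the undirected simple graph with vertex set $G$ in which distinct $a,b$ are adjacent iff $a=b^m$ or $b=a^n$ for some positive integers $m,n$. A graph is chordal if it has no induced cycle of length $4$ or more. $\mathrm{Sz}(q)={}^2B_2(q)$ is the Suzuki simple group over $GF(q)$. *)

theory Defs
  imports
    "HOL-Analysis.Analysis"
    "HOL-Algebra.Generated_Groups"
    "HOL-Number_Theory.Prime_Powers"
    "Graph_Theory.Pair_Digraph"
begin

text \<open>
  Undirected simple graphs are represented, as in \<open>Graph_Theory\<close> (locale \<open>pair_graph\<close>),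
  by symmetric irreflexive arc sets.
\<close>

definition power_graph :: "('a, 'b) monoid_scheme \<Rightarrow> 'a pair_pre_digraph" where
  "power_graph G =
     \<lparr>pverts = carrier G,
      parcs = {(a, b). a \<in> carrier G \<and> b \<in> carrier G \<and> a \<noteq> b \<and>
        ((\<exists>m::nat. m > 0 \<and> a = b [^]\<^bsub>G\<^esub> m) \<or> (\<exists>n::nat. n > 0 \<and> b = a [^]\<^bsub>G\<^esub> n))}\<rparr>"

text \<open>
  The vertices \<open>c 0, \<dots>, c (n - 1)\<close> are distinct and two of them are adjacent exactly if their
  indices are cyclically consecutive, i.e. they induce a cycle of length \<open>n\<close> (for \<open>n \<ge> 3\<close>).
\<close>

definition induced_cycle :: "'a pair_pre_digraph \<Rightarrow> nat \<Rightarrow> (nat \<Rightarrow> 'a) \<Rightarrow> bool" where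
  "induced_cycle H n c \<longleftrightarrow>
     inj_on c {..<n} \<and> c ` {..<n} \<subseteq> pverts H \<and>
     (\<forall>i<n. \<forall>j<n. (c i, c j) \<in> parcs H \<longleftrightarrow> j = (i + 1) mod n \<or> i = (j + 1) mod n)"

definition chordal :: "'a pair_pre_digraph \<Rightarrow> bool" where
  "chordal H \<longleftrightarrow> \<not> (\<exists>n c. n \<ge> 4 \<and> induced_cycle H n c)"

definition GL4 :: "('a::field ^ 4 ^ 4) monoid" where
  "GL4 = \<lparr>carrier = {A. invertible A}, monoid.mult = (**), one = mat 1\<rparr>"

text \<open>
  Suzuki's matrix generators of \<open>Sz(q) \<le> SL(4, q)\<close> for \<open>q = 2 ^ (2 * e + 1)\<close>. The map
  \<open>suz_theta e\<close> is the field automorphism of \<open>GF(q)\<close> whose square is \<open>x \<mapsto> x\<^sup>2\<close>.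
\<close>

definition suz_theta :: "nat \<Rightarrow> 'a::field \<Rightarrow> 'a" where
  "suz_theta e x = x ^ (2 ^ (e + 1))"

definition suz_S :: "nat \<Rightarrow> 'a::field \<Rightarrow> 'a \<Rightarrow> 'a ^ 4 ^ 4" where
  "suz_S e a b = vector
     [vector [1, 0, 0, 0],
      vector [a, 1, 0, 0],
      vector [b, suz_theta e a, 1, 0],
      vector [a\<^sup>2 * suz_theta e a + a * b + suz_theta e b, a * suz_theta e a + b, a, 1]]"

definition suz_M :: "nat \<Rightarrow> 'a::field \<Rightarrow> 'a ^ 4 ^ 4" where
  "suz_M e c = vector
     [vector [c ^ (1 + 2 ^ e), 0, 0, 0],
      vector [0, c ^ (2 ^ e), 0, 0],
      vector [0, 0, inverse (c ^ (2 ^ e)), 0],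
      vector [0, 0, 0, inverse (c ^ (1 + 2 ^ e))]]"

definition suz_T :: "'a::field ^ 4 ^ 4" where
  "suz_T = vector
     [vector [0, 0, 0, 1],
      vector [0, 0, 1, 0],
      vector [0, 1, 0, 0],
      vector [1, 0, 0, 0]]"

text \<open>
  \<open>Sz(q)\<close> is \<open>suzuki_group e\<close> over a field with \<open>q = 2 ^ (2 * e + 1)\<close> elements; no meaning is
  attached to other combinations of \<open>e\<close> and the field.
\<close>

definition suzuki_group :: "nat \<Rightarrow> ('a::field ^ 4 ^ 4) monoid" where
  "suzuki_group e =
     GL4\<lparr>carrier := generate GL4
       ({suz_S e a b |a b. True} \<union> {suz_M e c |c. c \<noteq> 0} \<union> {suz_T})\<rparr>"

definition primepow_or_prime_times_primepow :: "nat \<Rightarrow> bool" where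
  "primepow_or_prime_times_primepow n \<longleftrightarrow>
     primepow n \<or> (\<exists>p m. prime p \<and> primepow m \<and> n = p * m)"

end

theory Submission
  imports
    "HOL-Algebra.Algebraic_Closure_Type"
    "HOL-Algebra.Multiplicative_Group"
    "HOL-Number_Theory.Residues"
    Defs
begin

text \<open>
  In the power graph of a finite group, distinct elements are adjacent iff one is a power of the
  other. Being a power is transitive, so along an induced cycle of length at least 4 the directions
  of this relation alternate. In a cyclic group, \<open>x\<close> is a power of \<open>y\<close> iff the order of \<open>x\<close> divides
  the order of \<open>y\<close>, so an element of order \<open>N\<close> contributes the comparability graph of the divisors of
  \<open>N\<close>. That graph contains an induced hexagon if \<open>N\<close> has three prime divisors and an induced square
  if \<open>N\<close> is divisible by the squares of two primes (\<open>not_chordal_if_ord\<close>); if \<open>N = p * l ^ k\<close>, its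
  divisors form two chains, which leaves no room for an induced cycle. This accounts for the
  arithmetic condition. What remains is that the elements outside the 2-elements have orders
  dividing one of the three given numbers, that these numbers occur as orders, and that divisibility
  of orders decides the power relation between such elements if they commute
  (\<open>chordal_power_graph_if\<close>).

  All of this is read off from characteristic polynomials. Every element \<open>g\<close> of the Suzuki group is
  symplectic, and applying the automorphism \<open>\<theta>\<close> to its entries gives certain \<open>2 \<times> 2\<close> minors of \<open>g\<close>;
  these conditions (\<open>suzuki_matrix\<close>) are closed under multiplication. They imply
  \<open>A\<^sup>2 + t A + \<theta> t = 0\<close> for \<open>A = g + g\<^sup>-\<^sup>1\<close> and the trace \<open>t\<close> of \<open>g\<close> (\<open>suzuki_matrix_quadratic\<close>), so
  the eigenvalues of \<open>g\<close> are roots of \<open>x\<^sup>4 + t x\<^sup>3 + (\<theta> t) x\<^sup>2 + t x + 1\<close>. If \<open>t = 0\<close>, then \<open>g\<^sup>4 = 1\<close>.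
  If \<open>t \<noteq> 0\<close>, then this polynomial has four distinct roots in the algebraic closure, all of them
  roots of unity for one of the exponents \<open>q - 1\<close>, \<open>q + r + 1\<close>, \<open>q - r + 1\<close> (\<open>suz_char_roots\<close>), and \<open>g\<close> is
  diagonalizable with the same exponent.

  If \<open>t \<noteq> 0\<close>, the elements commuting with \<open>g\<close> act on an eigenvector of \<open>g\<close> by scalars. This action is
  faithful (\<open>commuting_fixing_eigenvector_eq_one\<close>), so the centralizer of \<open>g\<close> embeds into the
  multiplicative group of a field, where divisibility of orders does decide the power relation.
  Conversely, a primitive root of unity for each of the three exponents is a root of such a
  polynomial with \<open>t\<close> in \<open>GF(q)\<close> (\<open>suz_char_has_root_of_unity\<close>), and every \<open>t\<close> is the trace of some
  \<open>suz_T ** suz_S e 0 c\<close>; this yields elements of the three orders.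
\<close>

unbundle no fps_syntax
hide_const (open) Divisibility.prime

section \<open>Powers and adjacency\<close>

definition power_of :: "('a, 'b) monoid_scheme \<Rightarrow> 'a \<Rightarrow> 'a \<Rightarrow> bool" where
  "power_of G a b \<longleftrightarrow> (\<exists>k::nat. a = b [^]\<^bsub>G\<^esub> k)"

lemma (in group) power_of_trans:
  assumes "power_of G a b" "power_of G b c" "c \<in> carrier G"
  shows "power_of G a c"
  using assms by (auto simp: power_of_def nat_pow_pow)

lemma (in group) power_of_one:
  assumes "a \<in> carrier G"
  shows "power_of G \<one> a"
  unfolding power_of_def by (rule exI[of _ 0]) simp

text \<open>
  In a finite group every power of \<open>b\<close> is also a power with positive exponent, as the order of \<open>b\<close>
  can be added to the exponent.
\<close>

lemma (in group) arc_power_graph_iff: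
  assumes "finite (carrier G)"
  shows "(a, b) \<in> parcs (power_graph G) \<longleftrightarrow>
    a \<in> carrier G \<and> b \<in> carrier G \<and> a \<noteq> b \<and> (power_of G a b \<or> power_of G b a)"
proof -
  have "(\<exists>m::nat. m > 0 \<and> a = b [^] m) \<longleftrightarrow> power_of G a b" if "b \<in> carrier G" for a b
  proof
    assume "power_of G a b"
    then obtain k :: nat where "a = b [^] k"
      by (auto simp: power_of_def)
    then have "a = b [^] (k + ord b)"
      using that by (simp flip: nat_pow_mult)
    moreover have "k + ord b > 0"
      using ord_ge_1[OF assms that] by simp
    ultimately show "\<exists>m::nat. m > 0 \<and> a = b [^] m"
      by blast
  qed (auto simp: power_of_def)
  then show ?thesis
    by (auto simp: power_graph_def)
qed

section \<open>Divisors of a prime times a prime power\<close>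

lemma dvd_prime_times_prime_power:
  fixes p l d :: nat
  assumes "prime p" "prime l" "d dvd p * l ^ k"
  shows "\<exists>i. d = l ^ i \<or> d = p * l ^ i"
proof -
  obtain b c where bc: "d = b * c" "b dvd p" "c dvd l ^ k"
    using division_decomp[OF assms(3)] by auto
  obtain i where "c = l ^ i"
    using bc(3) divides_primepow_nat[OF assms(2)] by blast
  moreover have "b = 1 \<or> b = p"
    using bc(2) assms(1) by (auto simp: prime_nat_iff)
  ultimately show ?thesis
    using bc(1) by auto
qed

lemma prime_power_divisors_comparable:
  fixes l a b :: nat
  assumes "prime l" "a dvd l ^ i" "b dvd l ^ j"
  shows "a dvd b \<or> b dvd a"
proof -
  obtain m n where "a = l ^ m" "b = l ^ n"
    using assms(2,3) by (auto simp: divides_primepow_nat[OF assms(1)])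
  then show ?thesis
    using le_imp_power_dvd[of m n l] le_imp_power_dvd[of n m l] nle_le[of m n] by blast
qed

text \<open>
  The divisors form the two chains \<open>l ^ i\<close> and \<open>p * l ^ i\<close>, and two of the three lie in the same chain.
\<close>

lemma divisors_width_two:
  fixes p l a b c :: nat
  assumes "prime p" "prime l" "a dvd p * l ^ k" "b dvd p * l ^ k" "c dvd p * l ^ k"
  shows "a dvd b \<or> b dvd a \<or> b dvd c \<or> c dvd b \<or> a dvd c \<or> c dvd a"
proof -
  obtain i j m where "a = l ^ i \<or> a = p * l ^ i" "b = l ^ j \<or> b = p * l ^ j" "c = l ^ m \<or> c = p * l ^ m"
    using dvd_prime_times_prime_power[OF assms(1,2)] assms(3-5) by meson
  moreover have comparable: "l ^ x dvd l ^ y \<or> l ^ y dvd l ^ x" for x y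
    using prime_power_divisors_comparable[OF assms(2) dvd_refl dvd_refl] .
  then have "p * l ^ x dvd p * l ^ y \<or> p * l ^ y dvd p * l ^ x" for x y
    by (meson dvd_refl mult_dvd_mono)
  ultimately show ?thesis
    using comparable by (elim disjE) (simp_all, blast+)
qed

text \<open>
  If \<open>c\<close> or \<open>d\<close> is a power of \<open>l\<close>, then its divisors form a chain. Otherwise \<open>c\<close> and \<open>d\<close> both have the
  form \<open>p * l ^ i\<close>.
\<close>

lemma divisors_no_crossing:
  fixes p l a b c d :: nat
  assumes "prime p" "prime l" "c dvd p * l ^ k" "d dvd p * l ^ k"
    and "a dvd c" "b dvd c" "a dvd d" "b dvd d"
  shows "a dvd b \<or> b dvd a \<or> c dvd d \<or> d dvd c"
proof -
  obtain i j where ij: "c = l ^ i \<or> c = p * l ^ i" "d = l ^ j \<or> d = p * l ^ j"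
    using dvd_prime_times_prime_power[OF assms(1,2)] assms(3,4) by meson
  then consider "c = l ^ i" | "d = l ^ j" | "c = p * l ^ i" "d = p * l ^ j"
    by blast
  then show ?thesis
  proof cases
    case 1
    then show ?thesis
      using prime_power_divisors_comparable[OF assms(2)] assms(5,6) by blast
  next
    case 2
    then show ?thesis
      using prime_power_divisors_comparable[OF assms(2)] assms(7,8) by blast
  next
    case 3
    then show ?thesis
      using prime_power_divisors_comparable[OF assms(2) dvd_refl dvd_refl, of i j]
      by (meson dvd_refl mult_dvd_mono)
  qed
qed

text \<open>
  The exponent \<open>k = 0\<close> accounts for the primes, and \<open>p = l\<close> for the prime powers.
\<close>

lemma primepow_or_prime_times_primepow_iff:
  "primepow_or_prime_times_primepow n \<longleftrightarrow>
     (\<exists>p l k. prime p \<and> prime l \<and> n = p * l ^ k)"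
proof
  assume "primepow_or_prime_times_primepow n"
  then consider "primepow n" | p m where "prime p" "primepow m" "n = p * m"
    by (auto simp: primepow_or_prime_times_primepow_def)
  then show "\<exists>p l k. prime p \<and> prime l \<and> n = p * l ^ k"
  proof cases
    case 1
    then obtain p k where "prime p" "k > 0" "n = p ^ k"
      by (auto simp: primepow_def)
    then have "prime p \<and> prime p \<and> n = p * p ^ (k - 1)"
      by (simp add: power_eq_if)
    then show ?thesis by blast
  next
    case 2
    then show ?thesis by (auto simp: primepow_def)
  qed
next
  assume "\<exists>p l k. prime p \<and> prime l \<and> n = p * l ^ k"
  then obtain p l k where *: "prime p" "prime l" "n = p * l ^ k"
    by blast
  show "primepow_or_prime_times_primepow n"
  proof (cases "k = 0")
    case True
    then show ?thesis
      using * by (auto simp: primepow_or_prime_times_primepow_def primepow_prime)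
  next
    case False
    then have "primepow (l ^ k)"
      using * by (auto simp: primepow_def)
    then show ?thesis
      using * by (auto simp: primepow_or_prime_times_primepow_def)
  qed
qed

text \<open>
  If only two primes divide \<open>n\<close> and one of them has exponent 1, then \<open>n\<close> has the excluded form.
\<close>

lemma not_primepow_or_prime_times_primepow_cases:
  assumes "n > 1" "\<not> primepow_or_prime_times_primepow n"
  obtains (three) p l s where "prime p" "prime l" "prime s" "p \<noteq> l" "p \<noteq> s" "l \<noteq> s" "p * l * s dvd n"
  | (two) p l where "prime p" "prime l" "p \<noteq> l" "p\<^sup>2 * l\<^sup>2 dvd n"
proof -
  note bad = assms(2)[unfolded primepow_or_prime_times_primepow_iff, simplified]
  obtain p where p: "prime p" "p dvd n"
    using assms(1) prime_factor_nat[of n] by auto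
  obtain m where m: "n = p ^ multiplicity p n * m" "\<not> p dvd m"
    using multiplicity_decompose'[of n p] p assms(1) by (metis not_prime_unit not_less_zero)
  define a where "a = multiplicity p n"
  have a: "a > 0"
    unfolding a_def using p assms(1) by (simp add: prime_multiplicity_gt_zero_iff)
  have "m \<noteq> 1"
  proof
    assume "m = 1"
    then have "n = p * p ^ (a - 1)"
      using m(1) a by (simp add: a_def power_eq_if)
    then show False using bad p(1) by blast
  qed
  then obtain l where l: "prime l" "l dvd m"
    using prime_factor_nat by blast
  have "m \<noteq> 0" using m(1) assms(1) by (metis mult_0_right not_less_zero)
  then obtain m' where m': "m = l ^ multiplicity l m * m'" "\<not> l dvd m'"
    using multiplicity_decompose'[of m l] l by (metis not_prime_unit)
  define b where "b = multiplicity l m"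
  have b: "b > 0"
    unfolding b_def using l \<open>m \<noteq> 0\<close> by (simp add: prime_multiplicity_gt_zero_iff)
  have pl: "p \<noteq> l" using l m(2) by auto
  have n: "n = p ^ a * (l ^ b * m')"
    using m(1) m'(1) by (simp add: a_def b_def)
  show thesis
  proof (cases "m' = 1")
    case True
    have "a \<noteq> 1"
    proof
      assume "a = 1"
      then have "n = p * l ^ b" using n True by simp
      then show False using bad p(1) l(1) by blast
    qed
    moreover have "b \<noteq> 1"
    proof
      assume "b = 1"
      then have "n = l * p ^ a" using n True by simp
      then show False using bad p(1) l(1) by blast
    qed
    ultimately have "2 \<le> a" "2 \<le> b" using a b by auto
    then have "p\<^sup>2 dvd p ^ a" "l\<^sup>2 dvd l ^ b"
      by (auto intro: le_imp_power_dvd)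
    then show thesis
      using two[OF p(1) l(1) pl] n True by (simp add: mult_dvd_mono)
  next
    case False
    then obtain s where s: "prime s" "s dvd m'"
      using prime_factor_nat by blast
    have "s \<noteq> p" using s m(2) m'(1) by (metis dvd_mult)
    moreover have "s \<noteq> l" using s m'(2) by auto
    moreover have "p dvd p ^ a" "l dvd l ^ b"
      using a b by simp_all
    then have "p * (l * s) dvd n"
      unfolding n using s(2) by (intro mult_dvd_mono)
    ultimately show thesis
      using three[OF p(1) l(1) s(1) pl] by (auto simp: mult.assoc)
  qed
qed

section \<open>Induced cycles of divisors\<close>

text \<open>
  The element \<open>x [^] (ord x div d)\<close> has order \<open>d\<close>. In this way the divisors of \<open>ord x\<close>, ordered by
  divisibility, are represented by powers of \<open>x\<close>.
\<close>

lemma (in group) power_of_root_power_iff: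
  assumes x: "x \<in> carrier G" "ord x > 0" and "d dvd ord x" "d' dvd ord x"
  shows "power_of G (x [^] (ord x div d)) (x [^] (ord x div d')) \<longleftrightarrow> d dvd d'"
proof
  have ord_div: "ord (x [^] (ord x div c)) = c" if "c dvd ord x" for c
    using that x ord_pow[OF x(1), of "ord x div c"]
    by (metis div_div_eq_right div_dvd_iff_mult div_self dvd_div_eq_0_iff dvd_mult_div_cancel dvd_triv_left less_nat_zero_code mult_1 nat_less_le)
  assume "power_of G (x [^] (ord x div d)) (x [^] (ord x div d'))"
  then obtain k :: nat where k: "x [^] (ord x div d) = (x [^] (ord x div d')) [^] k"
    by (auto simp: power_of_def)
  have "(x [^] (ord x div d)) [^] d' = ((x [^] (ord x div d')) [^] d') [^] k"
    using k x(1) by (simp add: nat_pow_pow mult.commute mult.left_commute)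
  also have "(x [^] (ord x div d')) [^] d' = \<one>"
    using x(1) assms(4) by (simp add: nat_pow_pow)
  finally show "d dvd d'"
    using pow_eq_id[of "x [^] (ord x div d)" d'] ord_div[OF assms(3)] x(1) by simp
next
  assume "d dvd d'"
  then obtain k where k: "d' = d * k" by blast
  have "ord x div d = ord x div d' * k"
    using assms(2,4) unfolding k
    by (metis div_mult2_eq dvd_div_mult_self dvd_mult_right k div_mult_swap dvd_mult_div_cancel mult.commute nonzero_mult_div_cancel_left dvd_0_left_iff less_irrefl div_mult_mult1_if)
  then show "power_of G (x [^] (ord x div d)) (x [^] (ord x div d'))"
    using x(1) unfolding power_of_def by (metis nat_pow_pow)
qed

lemma (in group) not_chordal_if_divisor_cycle:
  assumes fin: "finite (carrier G)" and x: "x \<in> carrier G" and n: "length ds = n" "n \<ge> 4"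
    and ds: "distinct ds" "\<And>d. d \<in> set ds \<Longrightarrow> d dvd ord x"
    and cyc: "\<forall>i<n. \<forall>j<n. ds ! i \<noteq> ds ! j \<and> (ds ! i dvd ds ! j \<or> ds ! j dvd ds ! i) \<longleftrightarrow>
      j = (i + 1) mod n \<or> i = (j + 1) mod n"
  shows "\<not> chordal (power_graph G)"
proof -
  have pos: "ord x > 0"
    using ord_ge_1[OF fin x] by simp
  define c where "c i = x [^] (ord x div (ds ! i))" for i
  have c: "c i \<in> carrier G" for i
    by (simp add: c_def x)
  have pow_c: "power_of G (c i) (c j) \<longleftrightarrow> ds ! i dvd ds ! j" if "i < n" "j < n" for i j
    unfolding c_def using that n(1) by (intro power_of_root_power_iff x pos ds(2)) auto
  have c_eq: "c i = c j \<longleftrightarrow> ds ! i = ds ! j" if "i < n" "j < n" for i j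
  proof
    assume "c i = c j"
    then have "power_of G (c i) (c j)" "power_of G (c j) (c i)"
      unfolding power_of_def using c[of j] by (auto intro!: exI[of _ 1])
    then show "ds ! i = ds ! j"
      using pow_c that by (simp add: dvd_antisym)
  qed (simp add: c_def)
  have "induced_cycle (power_graph G) n c"
    unfolding induced_cycle_def
  proof (intro conjI allI impI)
    show "inj_on c {..<n}"
      using c_eq ds(1) n(1) by (auto simp: inj_on_def nth_eq_iff_index_eq)
    show "c ` {..<n} \<subseteq> pverts (power_graph G)"
      using c by (auto simp: power_graph_def)
    show "(c i, c j) \<in> parcs (power_graph G) \<longleftrightarrow> j = (i + 1) mod n \<or> i = (j + 1) mod n"
      if "i < n" "j < n" for i j
      using cyc that arc_power_graph_iff[OF fin] c pow_c c_eq by simp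
  qed
  then show ?thesis
    using n(2) by (auto simp: chordal_def)
qed

lemma all_less_4_iff: "(\<forall>i<4. P i) \<longleftrightarrow> P 0 \<and> P 1 \<and> P 2 \<and> P (3::nat)"
  by (simp add: eval_nat_numeral All_less_Suc) auto

lemma all_less_6_iff:
  "(\<forall>i<6. P i) \<longleftrightarrow> P 0 \<and> P 1 \<and> P 2 \<and> P 3 \<and> P 4 \<and> P (5::nat)"
  by (simp add: eval_nat_numeral All_less_Suc) auto

text \<open>
  Three primes \<open>p\<close>, \<open>l\<close>, \<open>s\<close> give the induced hexagon \<open>p\<close>, \<open>p l\<close>, \<open>l\<close>, \<open>l s\<close>, \<open>s\<close>, \<open>p s\<close> of divisors, and
  \<open>p\<^sup>2 l\<^sup>2\<close> gives the induced square \<open>p\<close>, \<open>p\<^sup>2 l\<close>, \<open>l\<close>, \<open>p l\<^sup>2\<close>.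
\<close>

lemma (in group) not_chordal_if_ord:
  assumes fin: "finite (carrier G)" and x: "x \<in> carrier G" "ord x > 1"
    and "\<not> primepow_or_prime_times_primepow (ord x)"
  shows "\<not> chordal (power_graph G)"
  using assms(3,4)
proof (cases rule: not_primepow_or_prime_times_primepow_cases)
  case (three p l s)
  have nd: "\<not> p dvd l" "\<not> p dvd s" "\<not> l dvd p" "\<not> l dvd s" "\<not> s dvd p" "\<not> s dvd l"
    using three primes_dvd_imp_eq by blast+
  have single_pair: "\<not> p dvd l * s" "\<not> l dvd p * s" "\<not> s dvd p * l"
    using nd three by (auto simp: prime_dvd_mult_iff)
  have pair_pair: "\<not> p * l dvd l * s" "\<not> p * l dvd p * s" "\<not> l * s dvd p * l"
    "\<not> l * s dvd p * s" "\<not> p * s dvd p * l" "\<not> p * s dvd l * s"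
    using single_pair by (meson dvd_mult_left dvd_mult_right)+
  have pair_single: "\<not> p * l dvd p" "\<not> p * l dvd l" "\<not> p * l dvd s"
    "\<not> l * s dvd p" "\<not> l * s dvd l" "\<not> l * s dvd s"
    "\<not> p * s dvd p" "\<not> p * s dvd l" "\<not> p * s dvd s"
    using nd by (meson dvd_mult_left dvd_mult_right)+
  have ne: "p \<noteq> p * l" "p \<noteq> l * s" "p \<noteq> p * s" "l \<noteq> p * l" "l \<noteq> l * s" "l \<noteq> p * s"
    "s \<noteq> p * l" "s \<noteq> l * s" "s \<noteq> p * s" "p * l \<noteq> l * s" "p * l \<noteq> p * s" "l * s \<noteq> p * s"
    using pair_pair pair_single by (metis dvd_refl)+
  let ?ds = "[p, p * l, l, l * s, s, p * s]"
  note table = nd single_pair pair_pair pair_single three(4-6) ne ne[symmetric] three(4-6)[symmetric]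
    dvd_triv_left dvd_triv_right dvd_refl
  show ?thesis
  proof (rule not_chordal_if_divisor_cycle[OF fin x(1), of ?ds 6])
    show "distinct ?ds"
      \<comment> \<open>The cancellation rules would rewrite the goal before the facts of the table apply.\<close>
      by (simp add: table del: mult_eq_self_implies_10 mult_cancel_left mult_cancel_right mult_cancel1 mult_cancel2)
    show "d dvd ord x" if "d \<in> set ?ds" for d
    proof -
      have "d dvd p * l * s" using that by auto
      then show ?thesis using three(7) dvd_trans by blast
    qed
    show "\<forall>i<6. \<forall>j<6. ?ds ! i \<noteq> ?ds ! j \<and> (?ds ! i dvd ?ds ! j \<or> ?ds ! j dvd ?ds ! i) \<longleftrightarrow>
      j = (i + 1) mod 6 \<or> i = (j + 1) mod 6"
      unfolding all_less_6_iff
      by (simp add: table del: mult_eq_self_implies_10 mult_cancel_left mult_cancel_right mult_cancel1 mult_cancel2 nat_mult_dvd_cancel_disj dvd_times_left_cancel_iff dvd_times_right_cancel_iff nat_dvd_1_iff_1)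
  qed simp_all
next
  case (two p l)
  have nd: "\<not> p dvd l" "\<not> l dvd p"
    using two primes_dvd_imp_eq by blast+
  have pos: "p \<noteq> 0" "l \<noteq> 0"
    using two by (auto simp: not_prime_0)
  have tops: "\<not> p * p * l dvd p * (l * l)" "\<not> p * (l * l) dvd p * p * l"
    using nd pos two by (auto simp: mult.assoc prime_dvd_mult_iff)
  have top_single: "\<not> p * p * l dvd p" "\<not> p * p * l dvd l" "\<not> p * (l * l) dvd p" "\<not> p * (l * l) dvd l"
    using nd by (meson dvd_mult_left dvd_mult_right)+
  have ne: "p * p * l \<noteq> p" "p * p * l \<noteq> l" "p * (l * l) \<noteq> p" "p * (l * l) \<noteq> l"
      "p * p * l \<noteq> p * (l * l)"
    using tops top_single by (metis dvd_refl)+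
  have single_top: "p dvd p * p * l" "l dvd p * p * l" "p dvd p * (l * l)" "l dvd p * (l * l)"
    by simp_all
  let ?ds = "[p, p * p * l, l, p * (l * l)]"
  note table = nd tops top_single ne ne[symmetric] two(3) two(3)[symmetric] single_top
  show ?thesis
  proof (rule not_chordal_if_divisor_cycle[OF fin x(1), of ?ds 4])
    show "distinct ?ds"
      by (simp add: table del: mult_eq_self_implies_10 mult_cancel_left mult_cancel_right mult_cancel1 mult_cancel2)
    show "d dvd ord x" if "d \<in> set ?ds" for d
    proof -
      have "d dvd p\<^sup>2 * l\<^sup>2" using that by (auto simp: power2_eq_square)
      then show ?thesis using two(4) dvd_trans by blast
    qed
    show "\<forall>i<4. \<forall>j<4. ?ds ! i \<noteq> ?ds ! j \<and> (?ds ! i dvd ?ds ! j \<or> ?ds ! j dvd ?ds ! i) \<longleftrightarrow>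
      j = (i + 1) mod 4 \<or> i = (j + 1) mod 4"
      unfolding all_less_4_iff
      by (simp add: table del: mult_eq_self_implies_10 mult_cancel_left mult_cancel_right mult_cancel1 mult_cancel2 nat_mult_dvd_cancel_disj dvd_times_left_cancel_iff dvd_times_right_cancel_iff)
  qed simp_all
qed

section \<open>Chordality from a cyclic centralizer structure\<close>

lemma (in group) eq_one_if_coprime_pows:
  assumes "x \<in> carrier G" "x [^] (m::nat) = \<one>" "x [^] n = \<one>" "coprime m n"
  shows "x = \<one>"
proof -
  have "ord x dvd gcd m n"
    using assms(1-3) by (simp add: pow_eq_id)
  then show ?thesis
    using assms(1,4) by (metis coprime_iff_gcd_eq_1 nat_dvd_1_iff_1 ord_eq_1)
qed

lemma (in group) pow_eq_one_power_of:
  assumes "power_of G a b" "b \<in> carrier G" "b [^] (n::nat) = \<one>"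
  shows "a [^] n = \<one>"
proof -
  obtain k :: nat where "a = b [^] k"
    using assms(1) by (auto simp: power_of_def)
  then have "a [^] n = (b [^] n) [^] k"
    using assms(2) by (simp add: nat_pow_pow mult.commute)
  then show ?thesis
    using assms(3) by simp
qed

lemma (in group) ord_dvd_ord_if_power_of:
  assumes "power_of G a b" "a \<in> carrier G" "b \<in> carrier G"
  shows "ord a dvd ord b"
  using pow_eq_one_power_of[OF assms(1,3), of "ord b"] assms(2,3) by (simp add: pow_eq_id)

lemma (in group) commute_if_power_of:
  assumes "power_of G a b" "b \<in> carrier G"
  shows "a \<otimes> b = b \<otimes> a"
  using assms unfolding power_of_def by (metis nat_pow_Suc nat_pow_Suc2)

lemma (in group) power_of_self: "a \<in> carrier G \<Longrightarrow> power_of G a a"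
  unfolding power_of_def by (rule exI[of _ 1]) simp

text \<open>
  Among the powers of an element whose order divides 4, the subgroups that they generate form a
  chain; \<open>y\<close> and \<open>y [^] 3\<close> generate the same one.
\<close>

lemma (in group) powers_comparable_if_pow4:
  assumes y: "y \<in> carrier G" "y [^] (4::nat) = \<one>" and "power_of G a y" "power_of G b y"
  shows "power_of G a b \<or> power_of G b a"
proof -
  have reduce: "y [^] k = y [^] (k mod 4)" for k :: nat
  proof -
    have "y [^] k = y [^] (4 * (k div 4) + k mod 4)" by simp
    also have "\<dots> = (y [^] (4::nat)) [^] (k div 4) \<otimes> y [^] (k mod 4)"
      using y(1) by (simp only: nat_pow_mult nat_pow_pow)
    finally show ?thesis using y by simp
  qed
  have cases: "x = \<one> \<or> x = y \<or> x = y [^] (2::nat) \<or> x = y [^] (3::nat)" if x: "power_of G x y" for x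
  proof -
    obtain k :: nat where "x = y [^] k"
      using x by (auto simp: power_of_def)
    then have "x = y [^] (k mod 4)"
      using reduce by metis
    moreover have "k mod 4 = 0 \<or> k mod 4 = 1 \<or> k mod 4 = 2 \<or> k mod 4 = 3"
      by presburger
    ultimately show ?thesis
      using y(1) by (elim disjE) simp_all
  qed
  have "(y [^] (3::nat)) [^] (3::nat) = y"
    using reduce[of 9] y(1) by (simp add: nat_pow_pow)
  then have "power_of G y (y [^] (3::nat))"
    unfolding power_of_def by metis
  moreover have "(y [^] (3::nat)) [^] (2::nat) = y [^] (2::nat)"
    using reduce[of 6] y(1) by (simp add: nat_pow_pow)
  then have "power_of G (y [^] (2::nat)) (y [^] (3::nat))"
    unfolding power_of_def by metis
  ultimately show ?thesis
    using cases[OF assms(3)] cases[OF assms(4)] assms(3,4) power_of_one y(1)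
    by (elim disjE) (simp_all add: power_of_self)
qed

text \<open>
  Let \<open>c\<close> be an induced cycle of length at least 4. If \<open>c 0 [^] 4 = \<one>\<close>, this carries over to its
  neighbours, and two non-adjacent vertices that are powers of a common neighbour contradict
  \<open>powers_comparable_if_pow4\<close>. Otherwise \<open>c 0 [^] N = \<one>\<close> for some \<open>N \<in> Ns\<close>. As the exponents are odd and
  pairwise coprime, this relation and the property of commuting with \<open>c 0\<close> propagate along the cycle.
  So all vertices commute with each other, and adjacency of distinct vertices means that the order of
  one divides the order of the other, where all orders divide \<open>N = p * l ^ k\<close>. A square is excluded
  by \<open>divisors_no_crossing\<close>; a longer cycle is either a pentagon, where directions cannot alternate, or
  it contains three pairwise incomparable vertices.
\<close>

lemma (in group) chordal_power_graph_if:
  assumes fin: "finite (carrier G)"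
    and exponents: "\<And>x. x \<in> carrier G \<Longrightarrow> x [^] (4::nat) = \<one> \<or> (\<exists>N\<in>Ns. x [^] N = \<one>)"
    and odd: "\<And>N. N \<in> Ns \<Longrightarrow> odd N"
    and coprime: "\<And>M N. M \<in> Ns \<Longrightarrow> N \<in> Ns \<Longrightarrow> M \<noteq> N \<Longrightarrow> coprime M N"
    and commute: "\<And>x y z. \<lbrakk>x \<in> carrier G; y \<in> carrier G; z \<in> carrier G; x [^] (4::nat) \<noteq> \<one>;
      x \<otimes> y = y \<otimes> x; x \<otimes> z = z \<otimes> x\<rbrakk> \<Longrightarrow> y \<otimes> z = z \<otimes> y"
    and cyclic: "\<And>y z. \<lbrakk>y \<in> carrier G; z \<in> carrier G; z [^] (4::nat) \<noteq> \<one>; y \<otimes> z = z \<otimes> y;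
      ord y dvd ord z\<rbrakk> \<Longrightarrow> power_of G y z"
    and form: "\<And>N. N \<in> Ns \<Longrightarrow> primepow_or_prime_times_primepow N"
  shows "chordal (power_graph G)"
  unfolding chordal_def
proof (intro notI, elim exE conjE)
  fix n c
  assume n: "n \<ge> 4" and "induced_cycle (power_graph G) n c"
  then have inj: "inj_on c {..<n}" and verts: "c ` {..<n} \<subseteq> carrier G"
    and arcs: "\<And>i j. i < n \<Longrightarrow> j < n \<Longrightarrow>
      (c i, c j) \<in> parcs (power_graph G) \<longleftrightarrow> j = (i + 1) mod n \<or> i = (j + 1) mod n"
    by (auto simp: induced_cycle_def power_graph_def)
  let ?le = "\<lambda>i j. power_of G (c i) (c j)"
  have c: "c i \<in> carrier G" if "i < n" for i
    using verts that by auto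
  have adj: "?le i j \<or> ?le j i" if "i < n" "j < n" "j = (i + 1) mod n" for i j
    using arcs[OF that(1,2)] that(3) arc_power_graph_iff[OF fin] by simp
  have nonadj: "\<not> ?le i j \<and> \<not> ?le j i"
    if "i < n" "j < n" "i \<noteq> j" "j \<noteq> (i + 1) mod n" "i \<noteq> (j + 1) mod n" for i j
  proof -
    have "c i \<noteq> c j"
      using inj that(1-3) by (auto simp: inj_on_def)
    then show ?thesis
      using arcs[OF that(1,2)] that(4,5) c that(1,2) arc_power_graph_iff[OF fin] by simp
  qed
  have trans: "?le i j \<Longrightarrow> ?le j k \<Longrightarrow> k < n \<Longrightarrow> ?le i k" for i j k
    using power_of_trans c by blast
  have adj01: "?le 0 1 \<or> ?le 1 0"
    by (rule adj) (use n in simp_all)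
  have adj12: "?le 1 2 \<or> ?le 2 1"
    by (rule adj) (use n in simp_all)
  have adj23: "?le 2 3 \<or> ?le 3 2"
    by (rule adj) (use n in simp_all)
  have non02: "\<not> ?le 0 2" "\<not> ?le 2 0"
  proof -
    have "\<not> ?le 0 2 \<and> \<not> ?le 2 0"
      by (rule nonadj) (use n in \<open>auto simp: mod_if\<close>)
    then show "\<not> ?le 0 2" "\<not> ?le 2 0" by simp_all
  qed
  have non13: "\<not> ?le 1 3" "\<not> ?le 3 1"
  proof -
    have "\<not> ?le 1 3 \<and> \<not> ?le 3 1"
      by (rule nonadj) (use n in \<open>auto simp: mod_if\<close>)
    then show "\<not> ?le 1 3" "\<not> ?le 3 1" by simp_all
  qed
  \<comment> \<open>The identity is adjacent to every vertex, so it does not lie on the cycle.\<close>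
  have ne_one: "c i \<noteq> \<one>" if i: "i < n" for i
  proof
    assume one: "c i = \<one>"
    define j where "j = (i + 2) mod n"
    have "j < n" "i \<noteq> j" "j \<noteq> (i + 1) mod n" "i \<noteq> (j + 1) mod n"
      unfolding j_def using n i by (auto simp: mod_if split: if_splits)
    then show False
      using nonadj[of i j] one power_of_one c i by simp
  qed
  have pow4: "b [^] (4::nat) = \<one>"
    if ab: "a \<in> carrier G" "b \<in> carrier G" "a \<noteq> \<one>" "power_of G a b \<or> power_of G b a"
      and a4: "a [^] (4::nat) = \<one>" for a b
  proof (cases "power_of G b a")
    case True
    then show ?thesis
      using pow_eq_one_power_of a4 ab by blast
  next
    case False
    show ?thesis
    proof (rule ccontr)
      assume "b [^] (4::nat) \<noteq> \<one>"
      then obtain N where N: "N \<in> Ns" "b [^] N = \<one>"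
        using exponents ab by blast
      then have "a [^] N = \<one>"
        using pow_eq_one_power_of ab False by blast
      moreover have "coprime 4 N"
        using odd[OF N(1)] coprime_power_left_iff[of 2 2 N] by simp
      ultimately show False
        using eq_one_if_coprime_pows a4 ab(1,3) by blast
    qed
  qed
  show False
  proof (cases "c 0 [^] (4::nat) = \<one>")
    case True
    have fixed: "c 1 [^] (4::nat) = \<one>" "c 2 [^] (4::nat) = \<one>"
    proof -
      show "c 1 [^] (4::nat) = \<one>"
        using pow4[of "c 0" "c 1"] True adj01 c ne_one n by simp
      then show "c 2 [^] (4::nat) = \<one>"
        using pow4[of "c 1" "c 2"] adj12 c ne_one n by simp
    qed
    have "(?le 0 1 \<and> ?le 2 1) \<or> (?le 1 2 \<and> ?le 3 2)"
      using adj01 adj12 adj23 non02 non13 trans[of 0 1 2] trans[of 2 1 0] trans[of 1 2 3]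
        trans[of 3 2 1] n by auto
    then show False
      using powers_comparable_if_pow4[OF _ fixed(1), of "c 0" "c 2"]
        powers_comparable_if_pow4[OF _ fixed(2), of "c 1" "c 3"] c n non02 non13 by auto
  next
    case False
    obtain N where N: "N \<in> Ns" "c 0 [^] N = \<one>"
      using exponents[OF c[of 0]] False n by auto
    have step: "b [^] (4::nat) \<noteq> \<one> \<and> b [^] N = \<one> \<and> a \<otimes> b = b \<otimes> a"
      if ab: "a \<in> carrier G" "b \<in> carrier G" "b \<noteq> \<one>" "power_of G a b \<or> power_of G b a"
        and a: "a [^] (4::nat) \<noteq> \<one>" "a [^] N = \<one>" for a b
    proof (intro conjI)
      show b4: "b [^] (4::nat) \<noteq> \<one>"
        using pow4[of b a] ab a(1) by blast
      show "a \<otimes> b = b \<otimes> a"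
        using ab commute_if_power_of by metis
      obtain M where M: "M \<in> Ns" "b [^] M = \<one>"
        using exponents[OF ab(2)] b4 by blast
      show "b [^] N = \<one>"
      proof (cases "M = N \<or> power_of G b a")
        case True
        then show ?thesis
          using M pow_eq_one_power_of a(2) ab(1) by blast
      next
        case False
        then have "a [^] M = \<one>"
          using pow_eq_one_power_of M(2) ab by blast
        then have "a = \<one>"
          using eq_one_if_coprime_pows[OF ab(1) _ a(2)] coprime[OF M(1) N(1)] False by blast
        then show ?thesis
          using a(1) by simp
      qed
    qed
    have all: "c i [^] (4::nat) \<noteq> \<one> \<and> c i [^] N = \<one> \<and> c 0 \<otimes> c i = c i \<otimes> c 0" if "i < n" for i
      using that
    proof (induction i)
      case 0
      then show ?case using False N(2) by simp
    next
      case (Suc i)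
      have prev: "c i [^] (4::nat) \<noteq> \<one>" "c i [^] N = \<one>" "c 0 \<otimes> c i = c i \<otimes> c 0"
        using Suc by simp_all
      have in_G: "c i \<in> carrier G" "c (Suc i) \<in> carrier G" "c 0 \<in> carrier G"
        using c Suc.prems n by simp_all
      have "?le i (Suc i) \<or> ?le (Suc i) i"
        by (rule adj) (use Suc.prems in simp_all)
      then have new: "c (Suc i) [^] (4::nat) \<noteq> \<one> \<and> c (Suc i) [^] N = \<one> \<and>
          c i \<otimes> c (Suc i) = c (Suc i) \<otimes> c i"
        by (intro step[OF in_G(1,2) ne_one _ prev(1,2)] Suc.prems)
      then show ?case
        using commute[OF in_G(1,3,2) prev(1) prev(3)[symmetric]] by simp
    qed
    have le_iff: "?le i j \<longleftrightarrow> ord (c i) dvd ord (c j)" if "i < n" "j < n" for i j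
    proof
      assume "ord (c i) dvd ord (c j)"
      moreover have "c i \<otimes> c j = c j \<otimes> c i"
        using commute[of "c 0" "c i" "c j"] False all c that n by simp
      ultimately show "?le i j"
        using cyclic all c that by simp
    qed (use ord_dvd_ord_if_power_of c that in blast)
    obtain p l k where plk: "prime p" "prime l" "N = p * l ^ k"
      using form[OF N(1)] primepow_or_prime_times_primepow_iff by auto
    have dvdN: "ord (c i) dvd p * l ^ k" if "i < n" for i
      using all[OF that] c[OF that] plk(3) pow_eq_id by auto
    consider "n = 4" | "n = 5" | "n \<ge> 6"
      using n by linarith
    then show False
    proof cases
      case 1
      have adj30: "?le 3 0 \<or> ?le 0 3"
        by (rule adj) (use 1 in simp_all)
      have "(?le 0 1 \<and> ?le 2 1 \<and> ?le 2 3 \<and> ?le 0 3) \<or> (?le 1 0 \<and> ?le 1 2 \<and> ?le 3 2 \<and> ?le 3 0)"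
        using adj01 adj12 adj23 adj30 non02 non13 trans[of 0 1 2] trans[of 2 1 0] trans[of 1 2 3]
          trans[of 3 2 1] trans[of 2 3 0] trans[of 0 3 2] 1 by auto
      then show False
      proof (elim disjE conjE)
        assume "?le 0 1" "?le 2 1" "?le 2 3" "?le 0 3"
        then show False
          using divisors_no_crossing[OF plk(1,2) dvdN[of 1] dvdN[of 3], of "ord (c 0)" "ord (c 2)"]
            le_iff non02 non13 1 by simp
      next
        assume "?le 1 0" "?le 1 2" "?le 3 2" "?le 3 0"
        then show False
          using divisors_no_crossing[OF plk(1,2) dvdN[of 0] dvdN[of 2], of "ord (c 1)" "ord (c 3)"]
            le_iff non02 non13 1 by simp
      qed
    next
      case 2
      \<comment> \<open>The direction of the arcs alternates along the cycle, which is impossible for odd length.\<close>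
      have adj34: "?le 3 4 \<or> ?le 4 3"
        by (rule adj) (use 2 in simp_all)
      have adj40: "?le 4 0 \<or> ?le 0 4"
        by (rule adj) (use 2 in simp_all)
      have "\<not> ?le 2 4 \<and> \<not> ?le 4 2"
        by (rule nonadj) (use 2 in simp_all)
      moreover have "\<not> ?le 3 0 \<and> \<not> ?le 0 3"
        by (rule nonadj) (use 2 in simp_all)
      moreover have "\<not> ?le 4 1 \<and> \<not> ?le 1 4"
        by (rule nonadj) (use 2 in simp_all)
      ultimately show False
        using adj01 adj12 adj23 adj34 adj40 non02 non13 trans[of 0 1 2] trans[of 2 1 0]
          trans[of 1 2 3] trans[of 3 2 1] trans[of 2 3 4] trans[of 4 3 2] trans[of 3 4 0]
          trans[of 0 4 3] trans[of 4 0 1] trans[of 1 0 4] 2 by auto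
    next
      case 3
      have "\<not> ?le 2 4 \<and> \<not> ?le 4 2"
        by (rule nonadj) (use 3 in \<open>auto simp: mod_if\<close>)
      moreover have "\<not> ?le 0 4 \<and> \<not> ?le 4 0"
        by (rule nonadj) (use 3 in \<open>auto simp: mod_if\<close>)
      ultimately show False
        using divisors_width_two[OF plk(1,2) dvdN[of 0] dvdN[of 2] dvdN[of 4]] le_iff non02 3
        by simp
    qed
  qed
qed

section \<open>The characteristic polynomial of a Suzuki element\<close>

lemma add_self_CHAR_2:
  fixes x :: "'k::field"
  assumes "CHAR('k) = 2"
  shows "x + x = 0"
  using uminus_CHAR_2[OF assms, of x] by (metis add.right_inverse)

lemma add_power_two_power:
  fixes x y :: "'k::field"
  assumes "CHAR('k) = 2"
  shows "(x + y) ^ (2 ^ n) = x ^ (2 ^ n) + y ^ (2 ^ n)"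
  using freshmans_dream'[of "2 ^ n" n x y] assms by simp

lemma power_two_power_inj:
  fixes x y :: "'k::field"
  assumes "CHAR('k) = 2" "x ^ (2 ^ n) = y ^ (2 ^ n)"
  shows "x = y"
proof -
  have "(x + y) ^ (2 ^ n) = 0"
    using add_power_two_power[OF assms(1)] add_self_CHAR_2[OF assms(1)] assms(2) by simp
  then have "x + y = 0" by simp
  then show ?thesis
    using minus_CHAR_2[OF assms(1), of x y] by simp
qed

lemma square_inj_CHAR_2:
  fixes x y :: "'k::field"
  assumes "CHAR('k) = 2" "x\<^sup>2 = y\<^sup>2"
  shows "x = y"
  using power_two_power_inj[of x 1 y] assms by simp

lemma add_inverse_eq_imp:
  fixes w z :: "'k::field"
  assumes "w \<noteq> 0" "z \<noteq> 0" "w + inverse w = z + inverse z"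
  shows "w = z \<or> w * z = 1"
proof -
  have "(w - z) * (w * z - 1) = 0"
    using assms by (simp add: field_simps)
  then show ?thesis by simp
qed

lemma suz_parameters:
  fixes e q r :: nat
  assumes "r = 2 ^ Suc e" "q = 2 ^ (2 * e + 1)"
  shows "r * r = 2 * q" "r \<le> q" "q > 0" "r > 0"
proof -
  show "r * r = 2 * q"
  proof -
    have "2 ^ (2 * e) = (2 ^ e * 2 ^ e :: nat)"
      by (simp add: mult_2 power_add)
    then show ?thesis
      unfolding assms by simp
  qed
  show "r \<le> q"
    unfolding assms by (rule power_increasing) simp_all
qed (simp_all add: assms)

text \<open>
  This is the characteristic polynomial of an element of the Suzuki group with trace \<open>\<tau>\<close>; the map
  \<open>x \<mapsto> x ^ r\<close> extends the automorphism \<open>suz_theta e\<close> of \<open>GF(q)\<close> when \<open>r = 2 ^ (e + 1)\<close>.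
\<close>

definition suz_char :: "nat \<Rightarrow> 'k::field \<Rightarrow> 'k \<Rightarrow> 'k" where
  "suz_char r \<tau> x = x ^ 4 + \<tau> * x ^ 3 + \<tau> ^ r * x\<^sup>2 + \<tau> * x + 1"

lemma suz_char_0 [simp]: "suz_char r \<tau> 0 = 1"
  by (simp add: suz_char_def)

text \<open>
  The polynomial is palindromic, hence quadratic in \<open>x + inverse x\<close>.
\<close>

lemma suz_char_altdef:
  fixes x :: "'k::field"
  assumes "CHAR('k) = 2" "x \<noteq> 0"
  shows "suz_char r \<tau> x = x\<^sup>2 * ((x + inverse x)\<^sup>2 + \<tau> * (x + inverse x) + \<tau> ^ r)"
proof -
  have "x\<^sup>2 * ((x + inverse x)\<^sup>2 + \<tau> * (x + inverse x) + \<tau> ^ r) = suz_char r \<tau> x + (x\<^sup>2 + x\<^sup>2)"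
    using assms(2) by (simp add: suz_char_def field_simps power2_eq_square power3_eq_cube power4_eq_xxxx)
  then show ?thesis
    using add_self_CHAR_2[OF assms(1)] by simp
qed

text \<open>
  For \<open>u = \<alpha> + inverse \<alpha>\<close> and \<open>v = \<beta> + inverse \<beta>\<close> the hypotheses amount to \<open>u ^ r + v ^ r = u * v\<close>. So \<open>u\<close>
  is a root of \<open>y\<^sup>2 + (u + v) y + (u + v) ^ r\<close>, whose constant term is \<open>u * v\<close>.
\<close>

lemma suz_char_eq_0_if_trace:
  fixes \<alpha> \<beta> :: "'k::field"
  assumes char: "CHAR('k) = 2" and "\<alpha> \<noteq> 0" "\<beta> \<noteq> 0"
    and r: "r = 2 ^ n"
    and 1: "\<alpha> * \<beta> = \<alpha> ^ r \<or> \<alpha> * \<beta> * \<alpha> ^ r = 1"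
    and 2: "\<beta> ^ r * \<beta> = \<alpha> \<or> \<beta> ^ r * \<alpha> = \<beta>"
  shows "suz_char r (\<alpha> + inverse \<alpha> + (\<beta> + inverse \<beta>)) \<alpha> = 0"
proof -
  define u where "u = \<alpha> + inverse \<alpha>"
  define v where "v = \<beta> + inverse \<beta>"
  have inv_pow: "inverse x ^ r = inverse (x ^ r)" for x :: 'k
    by (simp add: power_inverse)
  have a: "\<alpha> ^ r + inverse (\<alpha> ^ r) = \<alpha> * \<beta> + inverse (\<alpha> * \<beta>)"
    using 1
  proof
    assume "\<alpha> * \<beta> * \<alpha> ^ r = 1"
    then have "\<alpha> ^ r = inverse (\<alpha> * \<beta>)"
      by (metis inverse_unique)
    then show ?thesis by (simp add: add.commute)
  qed simp
  have b: "\<beta> ^ r + inverse (\<beta> ^ r) = \<alpha> * inverse \<beta> + inverse \<alpha> * \<beta>"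
    using 2
  proof
    assume "\<beta> ^ r * \<beta> = \<alpha>"
    then have "\<beta> ^ r = \<alpha> * inverse \<beta>" using assms(3) by (auto simp: field_simps)
    then show ?thesis by simp
  next
    assume "\<beta> ^ r * \<alpha> = \<beta>"
    then have "\<beta> ^ r = inverse \<alpha> * \<beta>" using assms(2) by (auto simp: field_simps)
    then show ?thesis by (simp add: add.commute)
  qed
  have "(u + v) ^ r = (\<alpha> * \<beta> + inverse (\<alpha> * \<beta>)) + (\<alpha> * inverse \<beta> + inverse \<alpha> * \<beta>)"
    unfolding r u_def v_def add_power_two_power[OF char]
    by (simp only: inv_pow[unfolded r] a[unfolded r] b[unfolded r])
  also have "\<dots> = u * v"
    by (simp add: u_def v_def algebra_simps)
  finally have "u\<^sup>2 + (u + v) * u + (u + v) ^ r = (u\<^sup>2 + u\<^sup>2) + (u * v + u * v)"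
    by (simp add: algebra_simps power2_eq_square)
  then have "u\<^sup>2 + (u + v) * u + (u + v) ^ r = 0"
    using add_self_CHAR_2[OF char] by simp
  then show ?thesis
    unfolding suz_char_altdef[OF char assms(2)] by (simp add: u_def v_def)
qed

text \<open>
  Let \<open>u = \<alpha> + inverse \<alpha>\<close>, and let \<open>v = \<beta> + inverse \<beta>\<close> be the other root of the quadratic polynomial in
  \<open>x + inverse x\<close>. The sums \<open>\<alpha> \<beta> + 1 / (\<alpha> \<beta>)\<close> and \<open>\<alpha> / \<beta> + \<beta> / \<alpha>\<close> add up to \<open>u v\<close> and have the product
  \<open>u\<^sup>2 + v\<^sup>2\<close>; by the assumptions on \<open>\<tau>\<close> the same holds for \<open>u ^ r\<close> and \<open>v ^ r\<close>, so these are the same two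
  elements. Replacing \<open>\<beta>\<close> by its inverse if necessary, \<open>\<alpha> \<beta>\<close> is \<open>\<alpha> ^ r\<close> or its inverse, and \<open>\<alpha> / \<beta>\<close> is
  \<open>\<beta> ^ r\<close> or its inverse. Elimination of \<open>\<beta>\<close> with \<open>r\<^sup>2 = 2 q\<close> gives \<open>\<alpha> ^ N = 1\<close> with \<open>N = q - 1\<close> if
  both signs agree and \<open>N = q - r + 1\<close> or \<open>N = q + r + 1\<close> if not.
\<close>

lemma suz_char_roots:
  fixes \<alpha> \<tau> :: "'k::alg_closed_field"
  assumes char: "CHAR('k) = 2" and r: "r = 2 ^ Suc e" and q: "q = 2 ^ (2 * e + 1)"
    and \<tau>: "\<tau> \<noteq> 0" "(\<tau> ^ r) ^ r = \<tau>\<^sup>2" and root: "suz_char r \<tau> \<alpha> = 0"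
  obtains \<beta> N where "\<alpha> \<noteq> 0" "\<beta> \<noteq> 0" "distinct [\<alpha>, inverse \<alpha>, \<beta>, inverse \<beta>]"
    "suz_char r \<tau> (inverse \<alpha>) = 0" "suz_char r \<tau> \<beta> = 0" "suz_char r \<tau> (inverse \<beta>) = 0"
    "N \<in> {q - 1, q + r + 1, q - r + 1}" "\<alpha> ^ N = 1" "\<beta> ^ N = 1"
proof -
  note self = add_self_CHAR_2[OF char]
  have \<alpha>0: "\<alpha> \<noteq> 0"
    using root by (auto simp: suz_char_def)
  define u where "u = \<alpha> + inverse \<alpha>"
  define v where "v = \<tau> + u"
  have \<tau>_uv: "\<tau> = u + v"
    unfolding v_def using self[of u] by (simp add: add.left_commute)
  have "\<exists>x. poly [:1, v, 1:] x = 0"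
    by (rule alg_closed_imp_poly_has_root) simp
  then obtain \<beta> where "poly [:1, v, 1:] \<beta> = 0" by blast
  then have *: "1 + \<beta> * (v + \<beta>) = 0" by simp
  then have \<beta>0: "\<beta> \<noteq> 0" by auto
  have "\<beta> * (v + \<beta>) = 1"
    using * uminus_CHAR_2[OF char, of 1] by (simp add: add_eq_0_iff)
  then have "v + \<beta> = inverse \<beta>"
    by (metis inverse_unique)
  then have v: "v = \<beta> + inverse \<beta>"
    using self[of \<beta>] by (metis add.commute add.left_commute add_0_right)
  have quad: "u\<^sup>2 + \<tau> * u + \<tau> ^ r = 0"
    using root suz_char_altdef[OF char \<alpha>0, of r \<tau>] \<alpha>0 by (simp add: u_def)
  have uv: "u * v = \<tau> ^ r"
  proof -
    have "u * v + \<tau> ^ r = 0"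
      using quad by (simp add: v_def algebra_simps power2_eq_square)
    then show ?thesis
      using minus_CHAR_2[OF char, of "u * v" "\<tau> ^ r"] by simp
  qed
  have roots: "suz_char r \<tau> x = 0" if "x \<noteq> 0" "x + inverse x = u \<or> x + inverse x = v" for x
  proof -
    have "u\<^sup>2 + \<tau> * u + \<tau> ^ r = (u\<^sup>2 + u\<^sup>2) + (u * v + u * v)"
      "v\<^sup>2 + \<tau> * v + \<tau> ^ r = (v\<^sup>2 + v\<^sup>2) + (u * v + u * v)"
      unfolding \<tau>_uv uv[unfolded \<tau>_uv, symmetric] by (simp_all add: algebra_simps power2_eq_square)
    then have "u\<^sup>2 + \<tau> * u + \<tau> ^ r = 0" "v\<^sup>2 + \<tau> * v + \<tau> ^ r = 0"
      by (simp_all only: self add_0_right)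
    then show ?thesis
      using that suz_char_altdef[OF char that(1), of r \<tau>] by auto
  qed
  have "u \<noteq> v" using \<tau>(1) \<tau>_uv self by auto
  have \<tau>r: "\<tau> ^ r \<noteq> 0" using \<tau>(1) by simp
  have ne_inv: "x \<noteq> inverse x" if "x \<noteq> 0" "x + inverse x = u \<or> x + inverse x = v" for x
  proof
    assume "x = inverse x"
    then have "x + inverse x = 0" using self by metis
    then have "u * v = 0" using that by auto
    then show False using uv \<tau>r by simp
  qed
  have distinct: "distinct [\<alpha>, inverse \<alpha>, \<beta>, inverse \<beta>]"
  proof -
    have "\<alpha> \<noteq> inverse \<alpha>" "\<beta> \<noteq> inverse \<beta>"
      using ne_inv \<alpha>0 \<beta>0 u_def v by blast+
    moreover have "\<alpha> \<noteq> \<beta>" "\<alpha> \<noteq> inverse \<beta>"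
      using \<open>u \<noteq> v\<close> u_def v by (auto simp: add.commute)
    ultimately show ?thesis by (auto simp: inverse_eq_iff_eq)
  qed
  have r_pow: "(x + y) ^ r = x ^ r + y ^ r" for x y :: 'k
    unfolding r by (rule add_power_two_power[OF char])
  have inv_pow: "x ^ r + inverse (x ^ r) = (x + inverse x) ^ r" for x :: 'k
    by (simp add: r_pow power_inverse)
  \<comment> \<open>Both pairs \<open>u ^ r\<close>, \<open>v ^ r\<close> and \<open>w\<^sub>1\<close>, \<open>w\<^sub>2\<close> have sum \<open>u * v\<close> and product \<open>(u + v)\<^sup>2\<close>.\<close>
  define w\<^sub>1 where "w\<^sub>1 = \<alpha> * \<beta> + inverse (\<alpha> * \<beta>)"
  define w\<^sub>2 where "w\<^sub>2 = \<alpha> * inverse \<beta> + inverse (\<alpha> * inverse \<beta>)"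
  have sum_w: "w\<^sub>1 + w\<^sub>2 = u ^ r + v ^ r"
  proof -
    have "w\<^sub>1 + w\<^sub>2 = u * v"
      by (simp add: w\<^sub>1_def w\<^sub>2_def u_def v algebra_simps)
    then show ?thesis
      using uv \<tau>_uv r_pow by simp
  qed
  have prod_w: "w\<^sub>1 * w\<^sub>2 = u ^ r * v ^ r"
  proof -
    have "w\<^sub>1 * w\<^sub>2 + (1 + 1) + (1 + 1) = u\<^sup>2 + v\<^sup>2"
      using \<alpha>0 \<beta>0 by (simp add: w\<^sub>1_def w\<^sub>2_def u_def v field_simps power2_eq_square)
    then have "w\<^sub>1 * w\<^sub>2 = u\<^sup>2 + v\<^sup>2"
      by (simp only: self add_0_right)
    also have "\<dots> = \<tau>\<^sup>2"
      using add_power_two_power[OF char, of u v 1] \<tau>_uv by simp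
    also have "\<dots> = u ^ r * v ^ r"
      unfolding \<tau>(2)[symmetric] uv[symmetric] by (rule power_mult_distrib)
    finally show ?thesis .
  qed
  have "(w\<^sub>1 - u ^ r) * (w\<^sub>1 - v ^ r) = w\<^sub>1 * (w\<^sub>1 + w\<^sub>2) - w\<^sub>1 * (u ^ r + v ^ r) + (u ^ r * v ^ r - w\<^sub>1 * w\<^sub>2)"
    by (simp add: algebra_simps)
  also have "\<dots> = 0"
    using sum_w prod_w by simp
  finally have w_cases: "(w\<^sub>1 = u ^ r \<and> w\<^sub>2 = v ^ r) \<or> (w\<^sub>1 = v ^ r \<and> w\<^sub>2 = u ^ r)"
    using sum_w by auto
  have \<gamma>: "\<exists>\<gamma>. \<gamma> \<noteq> 0 \<and> (\<gamma> = \<beta> \<or> \<gamma> = inverse \<beta>) \<and>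
    (\<alpha> * \<gamma> = \<alpha> ^ r \<or> \<alpha> * \<gamma> * \<alpha> ^ r = 1) \<and>
    (\<alpha> * inverse \<gamma> = \<gamma> ^ r \<or> \<alpha> * inverse \<gamma> * \<gamma> ^ r = 1)"
    using w_cases
  proof (elim disjE conjE)
    assume "w\<^sub>1 = u ^ r" "w\<^sub>2 = v ^ r"
    then have "\<alpha> * \<beta> + inverse (\<alpha> * \<beta>) = \<alpha> ^ r + inverse (\<alpha> ^ r)"
      "\<alpha> * inverse \<beta> + inverse (\<alpha> * inverse \<beta>) = \<beta> ^ r + inverse (\<beta> ^ r)"
      by (simp_all only: w\<^sub>1_def w\<^sub>2_def u_def v inv_pow)
    then show ?thesis
      using add_inverse_eq_imp[of "\<alpha> * \<beta>" "\<alpha> ^ r"] add_inverse_eq_imp[of "\<alpha> * inverse \<beta>" "\<beta> ^ r"] \<alpha>0 \<beta>0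
      by (intro exI[of _ \<beta>]) simp
  next
    assume "w\<^sub>1 = v ^ r" "w\<^sub>2 = u ^ r"
    then have "\<alpha> * \<beta> + inverse (\<alpha> * \<beta>) = \<beta> ^ r + inverse (\<beta> ^ r)"
      "\<alpha> * inverse \<beta> + inverse (\<alpha> * inverse \<beta>) = \<alpha> ^ r + inverse (\<alpha> ^ r)"
      by (simp_all only: w\<^sub>1_def w\<^sub>2_def u_def v inv_pow)
    moreover from this(1) have "\<alpha> * \<beta> + inverse (\<alpha> * \<beta>) = inverse \<beta> ^ r + inverse (inverse \<beta> ^ r)"
      by (simp add: power_inverse add.commute)
    ultimately show ?thesis
      using add_inverse_eq_imp[of "\<alpha> * \<beta>" "inverse \<beta> ^ r"] add_inverse_eq_imp[of "\<alpha> * inverse \<beta>" "\<alpha> ^ r"] \<alpha>0 \<beta>0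
      by (intro exI[of _ "inverse \<beta>"]) simp
  qed
  then obtain \<gamma> where \<gamma>: "\<gamma> \<noteq> 0" "\<gamma> = \<beta> \<or> \<gamma> = inverse \<beta>"
    "\<alpha> * \<gamma> = \<alpha> ^ r \<or> \<alpha> * \<gamma> * \<alpha> ^ r = 1" "\<alpha> * inverse \<gamma> = \<gamma> ^ r \<or> \<alpha> * inverse \<gamma> * \<gamma> ^ r = 1"
    by blast
  note rr = suz_parameters(1)[OF r q]
  have "r \<le> q" "q > 0"
    using suz_parameters[OF r q] by simp_all
  have sq: "\<alpha> ^ (2 * n) = (\<alpha> ^ n)\<^sup>2" for n
    by (simp add: power_mult power2_eq_square power_mult_distrib mult_2 power_add)
  have fixed: "\<alpha> ^ (q - 1) = 1" if "\<alpha> ^ (r * r) = \<alpha>\<^sup>2"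
  proof -
    have "\<alpha> ^ q = \<alpha>"
      using square_inj_CHAR_2[OF char, of "\<alpha> ^ q" \<alpha>] that rr sq by simp
    then show ?thesis
      using \<alpha>0 \<open>q > 0\<close> by (simp add: power_diff)
  qed
  have N: "\<exists>N\<in>{q - 1, q + r + 1, q - r + 1}. \<alpha> ^ N = 1"
    using \<gamma>(3,4)
  proof (elim disjE)
    assume a: "\<alpha> * \<gamma> = \<alpha> ^ r" and b: "\<alpha> * inverse \<gamma> = \<gamma> ^ r"
    have "\<alpha> ^ (r * r) * \<alpha> ^ r = (\<alpha> * \<gamma>) ^ r * (\<alpha> * \<gamma>)"
      by (simp add: a power_mult)
    also have "\<dots> = \<alpha> ^ r * \<alpha> * (\<gamma> ^ r * \<gamma>)"
      by (simp add: power_mult_distrib)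
    also have "\<gamma> ^ r * \<gamma> = \<alpha>"
      using b \<gamma>(1) by (simp flip: b)
    finally have "\<alpha> ^ (r * r) = \<alpha>\<^sup>2"
      using \<alpha>0 by (simp add: power2_eq_square)
    then show ?thesis using fixed by blast
  next
    assume a: "\<alpha> * \<gamma> = \<alpha> ^ r" and b: "\<alpha> * inverse \<gamma> * \<gamma> ^ r = 1"
    have b': "\<alpha> * \<gamma> ^ r = \<gamma>"
      using b \<gamma>(1) by (simp add: field_simps)
    have "\<alpha> ^ (r * r) * \<alpha>\<^sup>2 = (\<alpha> * \<gamma>) ^ r * \<alpha>\<^sup>2"
      by (simp add: a power_mult)
    also have "\<dots> = \<alpha> ^ r * \<alpha> * (\<alpha> * \<gamma> ^ r)"
      by (simp add: power_mult_distrib power2_eq_square)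
    also have "\<dots> = (\<alpha> ^ r)\<^sup>2"
      unfolding b' by (simp add: a mult.assoc power2_eq_square)
    finally have "(\<alpha> ^ (q + 1))\<^sup>2 = (\<alpha> ^ r)\<^sup>2"
      unfolding rr sq by (simp add: power_mult_distrib power2_eq_square algebra_simps)
    then have "\<alpha> ^ (q + 1) = \<alpha> ^ r"
      using square_inj_CHAR_2[OF char] by blast
    moreover have "q + 1 = (q - r + 1) + r"
      using \<open>r \<le> q\<close> by simp
    ultimately have "\<alpha> ^ (q - r + 1) * \<alpha> ^ r = \<alpha> ^ r"
      by (metis power_add)
    then have "\<alpha> ^ (q - r + 1) = 1" using \<alpha>0 by simp
    then show ?thesis by blast
  next
    assume a: "\<alpha> * \<gamma> * \<alpha> ^ r = 1" and b: "\<alpha> * inverse \<gamma> = \<gamma> ^ r"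
    have b': "\<gamma> ^ r * \<gamma> = \<alpha>"
      using \<gamma>(1) by (simp flip: b)
    have "1 = (\<alpha> * \<gamma> * \<alpha> ^ r) ^ r * (\<alpha> * \<gamma> * \<alpha> ^ r)"
      unfolding a by simp
    also have "\<dots> = \<alpha> ^ r * \<alpha> * (\<gamma> ^ r * \<gamma>) * \<alpha> ^ (r * r) * \<alpha> ^ r"
      by (simp add: power_mult_distrib power_mult)
    also have "\<dots> = (\<alpha> ^ (q + r + 1))\<^sup>2"
      unfolding b' rr sq by (simp add: power2_eq_square power_add algebra_simps)
    finally have "(\<alpha> ^ (q + r + 1))\<^sup>2 = 1\<^sup>2" by simp
    then have "\<alpha> ^ (q + r + 1) = 1"
      using square_inj_CHAR_2[OF char] by blast
    then show ?thesis by blast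
  next
    assume a: "\<alpha> * \<gamma> * \<alpha> ^ r = 1" and b: "\<alpha> * inverse \<gamma> * \<gamma> ^ r = 1"
    have b': "\<alpha> * \<gamma> ^ r = \<gamma>"
      using b \<gamma>(1) by (simp add: field_simps)
    have "\<alpha>\<^sup>2 * \<alpha> ^ r = \<alpha>\<^sup>2 * \<alpha> ^ r * (\<alpha> * \<gamma> * \<alpha> ^ r) ^ r"
      unfolding a by simp
    also have "\<dots> = (\<alpha> * \<gamma> * \<alpha> ^ r) * \<alpha> ^ (r * r) * \<alpha> ^ r"
      by (subst b'[symmetric]) (simp add: power_mult_distrib power_mult power2_eq_square algebra_simps)
    finally have "\<alpha> ^ (r * r) = \<alpha>\<^sup>2"
      unfolding a using \<alpha>0 by simp
    then show ?thesis using fixed by blast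
  qed
  then obtain N where N: "N \<in> {q - 1, q + r + 1, q - r + 1}" "\<alpha> ^ N = 1" by blast
  have "\<gamma> ^ N = 1"
  proof -
    have "(\<alpha> ^ k) ^ N = 1" for k
      using N(2) by (metis mult.commute power_mult power_one)
    moreover have "(\<alpha> * \<gamma>) ^ N = (\<alpha> ^ r) ^ N \<or> (\<alpha> * \<gamma> * \<alpha> ^ r) ^ N = 1"
      using \<gamma>(3) by (elim disjE) simp_all
    ultimately show ?thesis
      using N(2) by (auto simp: power_mult_distrib)
  qed
  then have "\<beta> ^ N = 1"
    using \<gamma>(2) by (auto simp: power_inverse)
  then show thesis
    using that[of \<beta> N] \<alpha>0 \<beta>0 distinct roots u_def v N by (auto simp: add.commute)
qed

section \<open>Roots of unity\<close>

lemma power_gcd_eq_one: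
  fixes x :: "'k::field"
  assumes "x ^ m = 1" "x ^ n = 1"
  shows "x ^ gcd m n = 1"
proof (cases "m = 0")
  case False
  then obtain a b where "m * a = n * b + gcd m n"
    using bezout_nat by blast
  then have "(x ^ m) ^ a = (x ^ n) ^ b * x ^ gcd m n"
    by (simp flip: power_mult power_add)
  then show ?thesis
    using assms by simp
qed (use assms in simp)

text \<open>
  A root of \<open>1 + x + \<dots> + x ^ (p - 1)\<close> differs from 1 because \<open>p\<close> is nonzero in the field, so it has order
  \<open>p\<close>; a root of it of degree \<open>p ^ (a - 1)\<close> then has order \<open>p ^ a\<close>.
\<close>

lemma exists_primitive_prime_power_root:
  fixes p :: nat
  assumes p: "prime p" "of_nat p \<noteq> (0 :: 'k::alg_closed_field)" and "a > 0"
  obtains z :: "'k::alg_closed_field" where "\<And>n. z ^ n = 1 \<longleftrightarrow> p ^ a dvd n"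
proof -
  have "p - 1 > 0"
    using prime_gt_1_nat[OF p(1)] by simp
  then obtain w :: 'k where w: "(\<Sum>k\<le>p - 1. 1 * w ^ k) = 0"
    using alg_closed[of "p - 1" "\<lambda>_. 1"] by auto
  have "w \<noteq> 1"
    using w p(2) \<open>p - 1 > 0\<close> by auto
  have "w ^ p = 1"
  proof -
    have "{..p - 1} = {..<p}"
      using \<open>p - 1 > 0\<close> by auto
    then have "(\<Sum>k<p. w ^ k) = 0"
      using w by simp
    then have "1 - w ^ p = 0"
      by (simp add: one_diff_power_eq)
    then show ?thesis by simp
  qed
  obtain z where z: "z ^ (p ^ (a - 1)) = w"
    using nth_root_exists[of "p ^ (a - 1)" w] prime_gt_0_nat[OF p(1)] by auto
  have z_pow: "z ^ (p ^ a) = 1"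
  proof -
    have "p ^ a = p ^ (a - 1) * p"
      using \<open>a > 0\<close> by (simp add: power_eq_if)
    then show ?thesis
      using z \<open>w ^ p = 1\<close> by (simp add: power_mult)
  qed
  show thesis
  proof (rule that[of z], rule iffI)
    fix n
    assume "z ^ n = 1"
    then have gcd: "z ^ gcd (p ^ a) n = 1"
      using power_gcd_eq_one z_pow by blast
    obtain i where i: "i \<le> a" "gcd (p ^ a) n = p ^ i"
      using divides_primepow_nat[OF p(1), of "gcd (p ^ a) n" a] by auto
    have "\<not> i \<le> a - 1"
    proof
      assume "i \<le> a - 1"
      then have "p ^ i dvd p ^ (a - 1)"
        by (simp add: le_imp_power_dvd)
      then have "z ^ (p ^ (a - 1)) = 1"
        using gcd i(2) by (auto simp: power_mult)
      then show False
        using z \<open>w \<noteq> 1\<close> by simp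
    qed
    then have "i = a" using i(1) by simp
    then show "p ^ a dvd n"
      using i(2) by (metis gcd_dvd2)
  next
    fix n
    assume "p ^ a dvd n"
    then show "z ^ n = 1"
      using z_pow by (auto simp: power_mult)
  qed
qed

text \<open>
  Primitive roots of unity of coprime orders multiply to one whose order is the product.
\<close>

lemma exists_primitive_root_of_unity:
  assumes "of_nat N \<noteq> (0 :: 'k::alg_closed_field)"
  obtains z :: "'k::alg_closed_field" where "\<And>n. z ^ n = 1 \<longleftrightarrow> N dvd n"
proof -
  have "\<exists>z::'k. \<forall>n. z ^ n = 1 \<longleftrightarrow> N dvd n"
    using assms
  proof (induction N rule: less_induct)
    case (less N)
    have "N \<noteq> 0" using less.prems by (metis of_nat_0)
    show ?case
    proof (cases "N = 1")
      case True
      then show ?thesis by (intro exI[of _ 1]) simp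
    next
      case False
      then obtain p where p: "prime p" "p dvd N"
        using prime_factor_nat by blast
      define a where "a = multiplicity p N"
      have "a > 0"
        unfolding a_def using p \<open>N \<noteq> 0\<close> by (simp add: prime_multiplicity_gt_zero_iff)
      obtain m where m: "N = p ^ a * m" "\<not> p dvd m"
        using multiplicity_decompose'[of N p] p \<open>N \<noteq> 0\<close> unfolding a_def by (metis not_prime_unit)
      have "m \<noteq> 0" using m(1) \<open>N \<noteq> 0\<close> by (metis mult_0_right)
      have "1 < p ^ a"
        by (rule one_less_power[OF prime_gt_1_nat[OF p(1)] \<open>a > 0\<close>])
      then have "m < N"
        using m(1) \<open>m \<noteq> 0\<close> by simp
      have nz: "of_nat p \<noteq> (0::'k)" "of_nat m \<noteq> (0::'k)"
        using less.prems unfolding m(1) using \<open>a > 0\<close> by auto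
      obtain y :: 'k where y: "\<And>n. y ^ n = 1 \<longleftrightarrow> m dvd n"
        using less.IH[OF \<open>m < N\<close> nz(2)] by blast
      obtain z :: 'k where z: "\<And>n. z ^ n = 1 \<longleftrightarrow> p ^ a dvd n"
        using exists_primitive_prime_power_root[OF p(1) nz(1) \<open>a > 0\<close>] by blast
      have cop: "coprime (p ^ a) m"
        using p(1) m(2) by (simp add: prime_imp_coprime)
      have "(y * z) ^ n = 1 \<longleftrightarrow> N dvd n" for n
      proof
        assume *: "(y * z) ^ n = 1"
        have "(y * z) ^ (n * m) = 1" "(y * z) ^ (n * p ^ a) = 1"
          unfolding power_mult * by simp_all
        moreover have "y ^ (n * m) = 1" "z ^ (n * p ^ a) = 1"
          using y z by simp_all
        ultimately have "p ^ a dvd n * m" "m dvd n * p ^ a"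
          using y z by (simp_all add: power_mult_distrib)
        then have "p ^ a dvd n" "m dvd n"
          using cop by (simp_all add: coprime_dvd_mult_left_iff coprime_commute)
        then show "N dvd n"
          unfolding m(1) using cop by (simp add: divides_mult)
      next
        assume "N dvd n"
        then have "p ^ a dvd n" "m dvd n"
          unfolding m(1) using dvd_mult_left dvd_mult_right by blast+
        then have "y ^ n = 1" "z ^ n = 1"
          using y z by simp_all
        then show "(y * z) ^ n = 1"
          by (simp add: power_mult_distrib)
      qed
      then show ?thesis by blast
    qed
  qed
  then show thesis
    using that by blast
qed

text \<open>
  The element \<open>\<tau>\<close> is \<open>\<alpha> + inverse \<alpha> + \<beta> + inverse \<beta>\<close> with \<open>\<beta> = \<alpha> ^ (r - 1)\<close> for \<open>N = q - 1\<close> and \<open>\<beta> = \<alpha> ^ q\<close>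
  otherwise. Raising to the power \<open>q\<close> fixes the four summands in the first case. In the second case it
  permutes them cyclically, because \<open>N\<close> divides \<open>q\<^sup>2 + 1 = (q + r + 1) (q - r + 1)\<close>.
\<close>

lemma suz_char_has_root_of_unity:
  fixes \<alpha> :: "'k::field"
  assumes char: "CHAR('k) = 2" and r: "r = 2 ^ Suc e" and q: "q = 2 ^ (2 * e + 1)"
    and N: "N \<in> {q - 1, q + r + 1, q - r + 1}" and \<alpha>: "\<alpha> ^ N = 1"
  obtains \<tau> where "\<tau> ^ q = \<tau>" "suz_char r \<tau> \<alpha> = 0"
proof -
  note rr = suz_parameters(1)[OF r q]
  have "r \<le> q" "q > 0" "r > 0"
    using suz_parameters[OF r q] by simp_all
  have "q \<ge> 2"
    unfolding q by simp
  have "N > 0"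
    using N \<open>q \<ge> 2\<close> by auto
  have \<alpha>0: "\<alpha> \<noteq> 0"
    using \<alpha> \<open>N > 0\<close> by (auto simp: power_0_left)
  have q_pow: "(x + y) ^ q = x ^ q + y ^ q" for x y :: 'k
    unfolding q by (rule add_power_two_power[OF char])
  have "\<exists>\<beta>. \<beta> \<noteq> 0 \<and> (\<alpha> * \<beta> = \<alpha> ^ r \<or> \<alpha> * \<beta> * \<alpha> ^ r = 1) \<and>
      (\<beta> ^ r * \<beta> = \<alpha> \<or> \<beta> ^ r * \<alpha> = \<beta>) \<and>
      (\<alpha> ^ q = \<alpha> \<and> \<beta> ^ q = \<beta> \<or> \<alpha> ^ q = \<beta> \<and> \<beta> ^ q = inverse \<alpha>)"
    using N
  proof (elim insertE)
    assume N: "N = q - 1"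
    have \<alpha>q: "\<alpha> ^ q = \<alpha>"
      using \<alpha> \<open>q > 0\<close> unfolding N by (metis One_nat_def Suc_pred mult.right_neutral power_Suc)
    define \<beta> where "\<beta> = \<alpha> ^ (r - 1)"
    have "\<alpha> * \<beta> = \<alpha> ^ r"
      unfolding \<beta>_def using \<open>r > 0\<close> by (simp flip: power_Suc)
    have "\<alpha> ^ r * (\<beta> ^ r * \<beta>) * \<alpha> = (\<alpha> * \<beta>) ^ r * (\<alpha> * \<beta>)"
      by (simp add: power_mult_distrib)
    also have "\<dots> = \<alpha> ^ r * (\<alpha> ^ q)\<^sup>2"
      unfolding \<open>\<alpha> * \<beta> = \<alpha> ^ r\<close> by (simp add: rr mult.commute flip: power_mult)
    finally have "\<beta> ^ r * \<beta> = \<alpha>"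
      using \<alpha>0 \<alpha>q by (simp add: power2_eq_square)
    moreover have "\<beta> ^ q = \<beta>"
      unfolding \<beta>_def using \<alpha>q by (metis mult.commute power_mult)
    ultimately show ?thesis
      using \<open>\<alpha> * \<beta> = \<alpha> ^ r\<close> \<alpha>q \<alpha>0 by (intro exI[of _ \<beta>]) (simp add: \<beta>_def)
  next
    assume N: "N = q + r + 1"
    have "(\<alpha> ^ N) ^ (q - r + 1) = \<alpha> ^ (q * q) * \<alpha>"
    proof -
      have "(q + r + 1) * (q - r + 1) + r * r = q * q + 2 * q + 1"
        using \<open>r \<le> q\<close> by (auto simp: algebra_simps dest!: le_Suc_ex)
      then have "N * (q - r + 1) = Suc (q * q)"
        unfolding N rr by simp
      then show ?thesis
        unfolding power_mult[symmetric] by simp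
    qed
    then have qq: "(\<alpha> ^ q) ^ q = inverse \<alpha>"
      using \<alpha> by (simp add: power_mult) (metis inverse_unique mult.commute)
    have *: "\<alpha> ^ q * \<alpha> ^ r * \<alpha> = 1"
      using \<alpha> unfolding N by (simp add: power_add mult.commute)
    have "(\<alpha> ^ q) ^ q * (\<alpha> ^ q) ^ r * \<alpha> ^ q = (\<alpha> ^ q * \<alpha> ^ r * \<alpha>) ^ q"
      by (simp add: power_mult_distrib power_commutes mult.commute flip: power_mult)
    then have "(\<alpha> ^ q) ^ r * \<alpha> ^ q = \<alpha>"
      using \<alpha>0 unfolding * qq by (simp add: field_simps)
    then show ?thesis
      using * \<alpha>0 qq by (intro exI[of _ "\<alpha> ^ q"]) (simp add: mult_ac)
  next
    assume N: "N = q - r + 1"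
    have "(\<alpha> ^ N) ^ (q + r + 1) = \<alpha> ^ (q * q) * \<alpha>"
    proof -
      have "(q - r + 1) * (q + r + 1) + r * r = q * q + 2 * q + 1"
        using \<open>r \<le> q\<close> by (auto simp: algebra_simps dest!: le_Suc_ex)
      then have "N * (q + r + 1) = Suc (q * q)"
        unfolding N rr by simp
      then show ?thesis
        unfolding power_mult[symmetric] by simp
    qed
    then have qq: "(\<alpha> ^ q) ^ q = inverse \<alpha>"
      using \<alpha> by (simp add: power_mult) (metis inverse_unique mult.commute)
    have "q + 1 = N + r"
      using \<open>r \<le> q\<close> unfolding N by simp
    then have *: "\<alpha> ^ q * \<alpha> = \<alpha> ^ r"
      using \<alpha> by (metis mult_1 power_add power_one_right)
    have "(\<alpha> ^ q) ^ q * \<alpha> ^ q = (\<alpha> ^ q * \<alpha>) ^ q"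
      by (simp add: power_mult_distrib)
    also have "\<dots> = (\<alpha> ^ q) ^ r"
      unfolding * by (simp add: mult.commute flip: power_mult)
    finally have "(\<alpha> ^ q) ^ r * \<alpha> = \<alpha> ^ q"
      using \<alpha>0 unfolding qq by (simp add: field_simps)
    then show ?thesis
      using * \<alpha>0 qq by (intro exI[of _ "\<alpha> ^ q"]) (simp add: mult_ac)
  qed simp
  then obtain \<beta> where \<beta>: "\<beta> \<noteq> 0" "\<alpha> * \<beta> = \<alpha> ^ r \<or> \<alpha> * \<beta> * \<alpha> ^ r = 1"
      "\<beta> ^ r * \<beta> = \<alpha> \<or> \<beta> ^ r * \<alpha> = \<beta>"
      "\<alpha> ^ q = \<alpha> \<and> \<beta> ^ q = \<beta> \<or> \<alpha> ^ q = \<beta> \<and> \<beta> ^ q = inverse \<alpha>"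
    by blast
  show thesis
  proof (rule that)
    show "(\<alpha> + inverse \<alpha> + (\<beta> + inverse \<beta>)) ^ q = \<alpha> + inverse \<alpha> + (\<beta> + inverse \<beta>)"
      using \<beta>(4) by (auto simp: q_pow power_inverse)
    show "suz_char r (\<alpha> + inverse \<alpha> + (\<beta> + inverse \<beta>)) \<alpha> = 0"
      by (rule suz_char_eq_0_if_trace[OF char \<alpha>0 \<beta>(1) r \<beta>(2,3)])
  qed
qed

lemma power_CARD_eq_self:
  fixes x :: "'a::{field,finite}"
  shows "x ^ CARD('a) = x"
proof (cases "x = 0")
  case False
  have bij: "bij_betw ((*) x) (UNIV - {0}) (UNIV - {0})"
    using False by (intro bij_betwI[of _ _ _ "(*) (inverse x)"]) auto
  have "prod id (UNIV - {0::'a}) = (\<Prod>y\<in>UNIV - {0}. x * y)"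
    using prod.reindex_bij_betw[OF bij, of id] by simp
  also have "\<dots> = x ^ card (UNIV - {0::'a}) * prod id (UNIV - {0})"
    by (simp add: prod.distrib)
  finally have "x ^ card (UNIV - {0::'a}) = 1"
    by simp
  moreover have "CARD('a) = Suc (card (UNIV - {0::'a}))"
    by (simp only: card_Suc_Diff1[OF finite UNIV_I])
  ultimately show ?thesis
    by (simp only: power_Suc mult_1_right)
qed simp

lemma CHAR_eq_2_if_CARD_two_power:
  assumes "CARD('a::{field,finite}) = 2 ^ n"
  shows "CHAR('a) = 2"
proof -
  have "prime CHAR('a)"
    by (rule prime_CHAR_semidom) (simp add: finite_imp_CHAR_pos)
  moreover have "CHAR('a) dvd 2 ^ n"
    using CHAR_dvd_CARD[where 'a = 'a] assms by simp
  ultimately show ?thesis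
    using prime_dvd_power primes_dvd_imp_eq two_is_prime_nat by blast
qed

text \<open>
  The polynomial \<open>x ^ q - x\<close> has at most \<open>q\<close> roots, and all elements of \<open>GF(q)\<close> are roots of it.
\<close>

lemma range_to_ac_eq:
  "range (to_ac :: 'a::{field,finite} \<Rightarrow> _) = {x. x ^ CARD('a) = x}"
proof (rule card_seteq)
  define p :: "'a alg_closure poly" where "p = Polynomial.monom 1 CARD('a) - Polynomial.monom 1 1"
  have "CARD('a) > 1"
    using card_mono[of UNIV "{0, 1::'a}"] by simp
  have coeff: "Polynomial.coeff p CARD('a) = 1"
    using \<open>CARD('a) > 1\<close> by (simp add: p_def)
  then have "p \<noteq> 0" by auto
  have roots: "{x. x ^ CARD('a) = x} = {x. poly p x = 0}"
    by (auto simp: p_def poly_monom)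
  show "finite {x :: 'a alg_closure. x ^ CARD('a) = x}"
    unfolding roots using \<open>p \<noteq> 0\<close> by (rule poly_roots_finite)
  have "Polynomial.degree p \<le> CARD('a)"
    unfolding p_def using \<open>CARD('a) > 1\<close> by (intro degree_diff_le) (simp_all add: degree_monom_eq)
  then show "card {x :: 'a alg_closure. x ^ CARD('a) = x} \<le> card (range (to_ac :: 'a \<Rightarrow> _))"
    unfolding roots using card_poly_roots_bound[OF \<open>p \<noteq> 0\<close>] by (simp add: card_image inj_to_ac)
  show "range (to_ac :: 'a \<Rightarrow> _) \<subseteq> {x. x ^ CARD('a) = x}"
    by (auto simp: power_CARD_eq_self simp flip: to_ac_power)
qed

section \<open>Symplectic matrices fixed by the twist\<close>

text \<open>
  The symplectic form with Gram matrix \<open>suz_T\<close> pairs the basis vector of index \<open>i\<close> with that of index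
  \<open>5 - i\<close>.
\<close>

definition rev4 :: "4 \<Rightarrow> 4" where
  "rev4 i = (if i = 1 then 4 else if i = 2 then 3 else if i = 3 then 2 else 1)"

lemma rev4_simps [simp]: "rev4 1 = 4" "rev4 2 = 3" "rev4 3 = 2" "rev4 4 = 1"
  by (simp_all add: rev4_def)

lemma rev4_rev4 [simp]: "rev4 (rev4 i) = i"
  using exhaust_4[of i] by auto

lemma sum_rev4: "(\<Sum>i\<in>UNIV. f (rev4 i)) = (\<Sum>i\<in>UNIV. f i)"
  by (rule sum.reindex_bij_witness[of _ rev4 rev4]) auto

text \<open>
  This is the adjoint of \<open>A\<close> with respect to that form, \<open>suz_T ** transpose A ** suz_T\<close>.
\<close>

definition sadj :: "'k::field ^ 4 ^ 4 \<Rightarrow> 'k ^ 4 ^ 4" where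
  "sadj A = (\<chi> i j. A $ rev4 j $ rev4 i)"

lemma sadj_nth [simp]: "sadj A $ i $ j = A $ rev4 j $ rev4 i"
  by (simp add: sadj_def)

lemma sadj_mult: "sadj (A ** B) = sadj B ** sadj A"
proof -
  have "(\<Sum>k\<in>UNIV. A $ rev4 j $ k * B $ k $ rev4 i) = (\<Sum>k\<in>UNIV. B $ rev4 k $ rev4 i * A $ rev4 j $ rev4 k)" for i j
    using sum_rev4[of "\<lambda>k. A $ rev4 j $ k * B $ k $ rev4 i"] by (simp add: mult.commute)
  then show ?thesis
    by (simp add: vec_eq_iff matrix_matrix_mult_def)
qed

lemma sadj_sadj [simp]: "sadj (sadj A) = A"
  by (simp add: vec_eq_iff)

lemma sadj_mat [simp]: "sadj (mat c) = mat c"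
  by (auto simp: vec_eq_iff mat_def) (metis rev4_rev4)+

lemma sadj_add: "sadj (A + B) = sadj A + sadj B"
  by (simp add: vec_eq_iff)

definition trace4 :: "'k::field ^ 4 ^ 4 \<Rightarrow> 'k" where
  "trace4 A = A $ 1 $ 1 + A $ 2 $ 2 + A $ 3 $ 3 + A $ 4 $ 4"

text \<open>
  In characteristic 2 this is the minor of \<open>A\<close> with rows \<open>i\<close>, \<open>j\<close> and columns \<open>k\<close>, \<open>l\<close>.
\<close>

definition minor2 :: "'k::field ^ 4 ^ 4 \<Rightarrow> 4 \<Rightarrow> 4 \<Rightarrow> 4 \<Rightarrow> 4 \<Rightarrow> 'k" where
  "minor2 A i j k l = A $ i $ k * A $ j $ l + A $ i $ l * A $ j $ k"

text \<open>
  The pairs \<open>(ix1 i, ix2 i)\<close> are 12, 13, 24, 34, those whose elements are not paired by the form. In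
  characteristic 2 the exterior square of the natural module has the invariant vector
  \<open>e\<^sub>1 \<and> e\<^sub>4 + e\<^sub>2 \<and> e\<^sub>3\<close>, and the four pairs index a basis of the orthogonal complement of this vector
  modulo the vector itself.
\<close>

definition ix1 :: "4 \<Rightarrow> 4" where
  "ix1 i = (if i = 1 then 1 else if i = 2 then 1 else if i = 3 then 2 else 3)"

definition ix2 :: "4 \<Rightarrow> 4" where
  "ix2 i = (if i = 1 then 2 else if i = 2 then 3 else if i = 3 then 4 else 4)"

lemma ix_simps [simp]:
  "ix1 1 = 1" "ix1 2 = 1" "ix1 3 = 2" "ix1 4 = 3"
  "ix2 1 = 2" "ix2 2 = 3" "ix2 3 = 4" "ix2 4 = 4"
  by (simp_all add: ix1_def ix2_def)

text \<open>
  In characteristic 2 the action of the symplectic group on the four-dimensional module just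
  described is again symplectic. The last condition says that this action of \<open>A\<close> is the one obtained
  by applying \<open>\<theta>\<close> to the entries of \<open>A\<close>, which is how the Suzuki group arises as a group of fixed points
  inside the symplectic group.
\<close>

definition suzuki_matrix :: "nat \<Rightarrow> 'k::field ^ 4 ^ 4 \<Rightarrow> bool" where
  "suzuki_matrix e A \<longleftrightarrow> A ** sadj A = mat 1 \<and> sadj A ** A = mat 1 \<and>
     (\<forall>i j. suz_theta e (A $ i $ j) = minor2 A (ix1 i) (ix2 i) (ix1 j) (ix2 j))"

lemma suz_theta_add:
  fixes x y :: "'k::field"
  assumes "CHAR('k) = 2"
  shows "suz_theta e (x + y) = suz_theta e x + suz_theta e y"
  unfolding suz_theta_def by (rule add_power_two_power[OF assms])

lemma suz_theta_mult: "suz_theta e (x * y) = suz_theta e x * suz_theta e y"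
  by (simp add: suz_theta_def power_mult_distrib)

lemma suz_theta_simps [simp]: "suz_theta e 0 = 0" "suz_theta e 1 = 1"
  by (simp_all add: suz_theta_def power_0_left)

text \<open>
  This is the Cauchy-Binet formula; the terms in which both factors use the same intermediate index
  occur twice and vanish.
\<close>

lemma minor2_mult:
  fixes A B :: "'k::field ^ 4 ^ 4"
  assumes "CHAR('k) = 2"
  shows "minor2 (A ** B) a b c d =
    minor2 A a b 1 2 * minor2 B 1 2 c d + minor2 A a b 1 3 * minor2 B 1 3 c d +
    minor2 A a b 2 4 * minor2 B 2 4 c d + minor2 A a b 3 4 * minor2 B 3 4 c d +
    minor2 A a b 1 4 * minor2 B 1 4 c d + minor2 A a b 2 3 * minor2 B 2 3 c d"
    (is "_ = ?R")
proof -
  define D where "D = (\<Sum>k\<in>UNIV. A $ a $ k * A $ b $ k * B $ k $ c * B $ k $ d)"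
  have "minor2 (A ** B) a b c d = ?R + (D + D)"
    by (simp add: minor2_def D_def matrix_matrix_mult_def sum_4 algebra_simps)
  then show ?thesis
    using add_self_CHAR_2[OF assms, of D] by simp
qed

lemma eq_if_add_eq_0_CHAR_2:
  fixes x y :: "'k::field"
  assumes "CHAR('k) = 2" "x + y = 0"
  shows "x = y"
  using minus_CHAR_2[OF assms(1), of x y] assms(2) by simp

lemma symplectic_columns:
  fixes A :: "'k::field ^ 4 ^ 4"
  assumes "sadj A ** A = mat 1"
  shows "minor2 A 1 4 i j + minor2 A 2 3 i j = (if i = rev4 j then 1 else 0)"
proof -
  have "(sadj A ** A) $ rev4 i $ j = (if i = rev4 j then 1 else 0)"
    unfolding assms by (auto simp: mat_def)
  then show ?thesis
    by (simp add: matrix_matrix_mult_def sum_4 minor2_def algebra_simps)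
qed

lemma symplectic_rows:
  fixes A :: "'k::field ^ 4 ^ 4"
  assumes "A ** sadj A = mat 1"
  shows "minor2 A i j 1 4 + minor2 A i j 2 3 = (if i = rev4 j then 1 else 0)"
proof -
  have "(A ** sadj A) $ i $ rev4 j = (if i = rev4 j then 1 else 0)"
    unfolding assms by (auto simp: mat_def)
  then show ?thesis
    by (simp add: matrix_matrix_mult_def sum_4 minor2_def algebra_simps)
qed

lemma ix1_ne_rev4_ix2: "ix1 i \<noteq> rev4 (ix2 i)"
  using exhaust_4[of i] by auto

text \<open>
  By the Cauchy-Binet formula the minors of \<open>A ** B\<close> in question are those of the product of the
  twisted matrices, up to the terms for the intermediate pairs 14 and 23. The symplectic relations
  between rows of \<open>A\<close> and between columns of \<open>B\<close> make these two terms equal, so they cancel.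
\<close>

lemma suzuki_matrix_mult:
  fixes A B :: "'k::field ^ 4 ^ 4"
  assumes char: "CHAR('k) = 2" and A: "suzuki_matrix e A" and B: "suzuki_matrix e B"
  shows "suzuki_matrix e (A ** B)"
  unfolding suzuki_matrix_def
proof (intro conjI allI)
  have A_adj: "A ** sadj A = mat 1" "sadj A ** A = mat 1" and B_adj: "B ** sadj B = mat 1" "sadj B ** B = mat 1"
    using A B by (simp_all add: suzuki_matrix_def)
  have "A ** B ** sadj (A ** B) = A ** (B ** sadj B) ** sadj A"
    by (simp only: sadj_mult matrix_mul_assoc)
  then show "A ** B ** sadj (A ** B) = mat 1"
    using A_adj B_adj by simp
  have "sadj (A ** B) ** (A ** B) = sadj B ** (sadj A ** A) ** B"
    by (simp only: sadj_mult matrix_mul_assoc)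
  then show "sadj (A ** B) ** (A ** B) = mat 1"
    using A_adj B_adj by simp
  fix i j
  let ?mA = "minor2 A (ix1 i) (ix2 i)" and ?mB = "\<lambda>k l. minor2 B k l (ix1 j) (ix2 j)"
  have "?mA 1 4 = ?mA 2 3"
  proof (rule eq_if_add_eq_0_CHAR_2[OF char])
    show "?mA 1 4 + ?mA 2 3 = 0"
      using symplectic_rows[OF A_adj(1), of "ix1 i" "ix2 i"] ix1_ne_rev4_ix2[of i] by simp
  qed
  moreover have "?mB 1 4 = ?mB 2 3"
  proof (rule eq_if_add_eq_0_CHAR_2[OF char])
    show "?mB 1 4 + ?mB 2 3 = 0"
      using symplectic_columns[OF B_adj(2), of "ix1 j" "ix2 j"] ix1_ne_rev4_ix2[of j] by simp
  qed
  ultimately have extra: "?mA 1 4 * ?mB 1 4 + ?mA 2 3 * ?mB 2 3 = 0"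
    by (simp only: add_self_CHAR_2[OF char])
  have "suz_theta e ((A ** B) $ i $ j) =
      (\<Sum>k\<in>UNIV. suz_theta e (A $ i $ k) * suz_theta e (B $ k $ j))"
    by (simp add: matrix_matrix_mult_def sum_4 suz_theta_add[OF char] suz_theta_mult)
  also have "\<dots> = (\<Sum>k\<in>UNIV. ?mA (ix1 k) (ix2 k) * ?mB (ix1 k) (ix2 k))"
    using A B by (simp add: suzuki_matrix_def)
  also have "\<dots> = minor2 (A ** B) (ix1 i) (ix2 i) (ix1 j) (ix2 j)"
    using extra by (simp add: minor2_mult[OF char] sum_4 add.assoc)
  finally show "suz_theta e ((A ** B) $ i $ j) = minor2 (A ** B) (ix1 i) (ix2 i) (ix1 j) (ix2 j)" .
qed

lemma suzuki_matrix_one: "suzuki_matrix e (mat 1 :: 'k::field ^ 4 ^ 4)"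
proof -
  have "\<forall>i j. suz_theta e ((mat 1 :: 'k ^ 4 ^ 4) $ i $ j) = minor2 (mat 1) (ix1 i) (ix2 i) (ix1 j) (ix2 j)"
    by (simp add: forall_4 mat_def minor2_def)
  then show ?thesis
    by (simp add: suzuki_matrix_def)
qed

lemma suzuki_matrix_sadj:
  assumes "suzuki_matrix e A"
  shows "suzuki_matrix e (sadj A)"
  using assms unfolding suzuki_matrix_def by (simp add: forall_4 minor2_def algebra_simps)

lemma vector_4 [simp]:
  fixes a b c d :: "'k::zero"
  shows "(vector [a, b, c, d] :: 'k ^ 4) $ 1 = a" "(vector [a, b, c, d] :: 'k ^ 4) $ 2 = b"
    "(vector [a, b, c, d] :: 'k ^ 4) $ 3 = c" "(vector [a, b, c, d] :: 'k ^ 4) $ 4 = d"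
  by (simp_all add: vector_def)

lemma suzuki_matrix_suz_T: "suzuki_matrix e (suz_T :: 'k::field ^ 4 ^ 4)"
  unfolding suzuki_matrix_def
  by (simp add: vec_eq_iff forall_4 matrix_matrix_mult_def sum_4 suz_T_def minor2_def mat_def)

lemma suzuki_matrix_suz_M:
  fixes c :: "'k::field"
  assumes "c \<noteq> 0" "c ^ (2 ^ (2 * e + 1)) = c"
  shows "suzuki_matrix e (suz_M e c)"
proof -
  define m where "m = c ^ (2 ^ e)"
  have "m \<noteq> 0" using assms(1) by (simp add: m_def)
  have M: "suz_M e c = vector [vector [c * m, 0, 0, 0], vector [0, m, 0, 0],
      vector [0, 0, inverse m, 0], vector [0, 0, 0, inverse (c * m)]]"
    by (simp add: suz_M_def m_def power_add)
  have "2 ^ e * 2 ^ (e + 1) = (2 ^ (2 * e + 1) :: nat)"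
    unfolding power_add[symmetric] by (simp add: mult_2)
  then have m_theta: "suz_theta e m = c"
    unfolding suz_theta_def m_def power_mult[symmetric] using assms(2) by (simp only:)
  have c_theta: "suz_theta e c = m * m"
    by (simp add: suz_theta_def m_def mult_2 flip: power_add)
  have inv: "suz_theta e (inverse x) = inverse (suz_theta e x)" for x :: 'k
    by (simp add: suz_theta_def power_inverse)
  show ?thesis
    unfolding suzuki_matrix_def M using assms(1) \<open>m \<noteq> 0\<close>
    by (simp add: vec_eq_iff forall_4 matrix_matrix_mult_def sum_4 minor2_def mat_def
        suz_theta_mult m_theta c_theta inv) (simp add: field_simps)
qed

lemma suzuki_matrix_suz_S:
  fixes a b :: "'k::field"
  assumes char: "CHAR('k) = 2"
    and "suz_theta e (suz_theta e a) = a\<^sup>2" "suz_theta e (suz_theta e b) = b\<^sup>2"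
  shows "suzuki_matrix e (suz_S e a b)"
proof -
  note self = add_self_CHAR_2[OF char]
  have self': "x + (x + y) = y" for x y :: 'k
    using self[of x] by (simp only: add.assoc[symmetric] add_0_left)
  have "suz_S e a b ** sadj (suz_S e a b) = mat 1"
    by (simp add: vec_eq_iff forall_4 matrix_matrix_mult_def sum_4 mat_def suz_S_def
        algebra_simps power2_eq_square self self' del: mult_2 mult_2_right)
  moreover from this have "sadj (suz_S e a b) ** suz_S e a b = mat 1"
    using matrix_left_right_inverse by blast
  moreover have "\<forall>i j. suz_theta e (suz_S e a b $ i $ j)
      = minor2 (suz_S e a b) (ix1 i) (ix2 i) (ix1 j) (ix2 j)"
    by (simp add: forall_4 minor2_def suz_S_def suz_theta_add[OF char] suz_theta_mult assms(2,3)
        algebra_simps power2_eq_square self self')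
  ultimately show ?thesis
    by (simp add: suzuki_matrix_def)
qed

text \<open>
  The matrix \<open>suz_T ** N\<close> is alternating, so \<open>N\<close> satisfies a polynomial of degree 2, half the degree of
  its characteristic polynomial. In terms of the six independent entries of \<open>N\<close> the coefficients are
  \<open>r + s\<close>, which is the trace of \<open>A\<close>, and the Pfaffian \<open>p w + q u + r s\<close>. The Pfaffian is the sum of
  the four principal minors of \<open>A\<close> for the pairs 12, 13, 24, 34, up to two minors that cancel by the
  symplectic relations; the twist identifies that sum with \<open>\<theta>\<close> applied to the trace.
\<close>

lemma suzuki_matrix_quadratic:
  fixes A :: "'k::field ^ 4 ^ 4"
  assumes char: "CHAR('k) = 2" and A: "suzuki_matrix e A"
  defines "N \<equiv> A + sadj A"
  shows "N ** N = mat (trace4 A) ** N + mat (suz_theta e (trace4 A))"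
proof -
  note self = add_self_CHAR_2[OF char]
  have self': "x + (x + y) = y" for x y :: 'k
    using self[of x] by (simp only: add.assoc[symmetric] add_0_left)
  have symp: "A ** sadj A = mat 1" "sadj A ** A = mat 1"
    and minors: "\<And>i j. suz_theta e (A $ i $ j) = minor2 A (ix1 i) (ix2 i) (ix1 j) (ix2 j)"
    using A by (simp_all add: suzuki_matrix_def)
  define r s where "r = N $ 1 $ 1" and "s = N $ 2 $ 2"
  define p w where "p = N $ 3 $ 1" and "w = N $ 1 $ 3"
  define q u where "q = N $ 2 $ 1" and "u = N $ 1 $ 2"
  have N_entries: "N $ 1 $ 1 = r" "N $ 1 $ 2 = u" "N $ 1 $ 3 = w" "N $ 1 $ 4 = 0"
    "N $ 2 $ 1 = q" "N $ 2 $ 2 = s" "N $ 2 $ 3 = 0" "N $ 2 $ 4 = w"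
    "N $ 3 $ 1 = p" "N $ 3 $ 2 = 0" "N $ 3 $ 3 = s" "N $ 3 $ 4 = u"
    "N $ 4 $ 1 = 0" "N $ 4 $ 2 = p" "N $ 4 $ 3 = q" "N $ 4 $ 4 = r"
    unfolding r_def s_def p_def w_def q_def u_def N_def by (simp_all add: self add.commute del: mult_2 mult_2_right)
  have trace: "trace4 A = r + s"
    by (simp add: trace4_def r_def s_def N_def add_ac)
  have "minor2 A 1 4 2 3 + minor2 A 2 3 1 4 = 0"
  proof -
    have "minor2 A 1 4 1 4 + minor2 A 1 4 2 3 = 1" "minor2 A 1 4 1 4 + minor2 A 2 3 1 4 = 1"
      using symplectic_rows[OF symp(1), of 1 4] symplectic_columns[OF symp(2), of 1 4] by simp_all
    then have "minor2 A 1 4 2 3 = minor2 A 2 3 1 4"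
      by (metis add_left_cancel)
    then show ?thesis
      by (simp only: self)
  qed
  moreover have "p * w + q * u + r * s + (minor2 A 1 4 2 3 + minor2 A 2 3 1 4) =
      minor2 A 1 2 1 2 + minor2 A 1 3 1 3 + minor2 A 2 4 2 4 + minor2 A 3 4 3 4"
    unfolding p_def w_def q_def u_def r_def s_def N_def
    by (simp add: minor2_def algebra_simps self self' del: mult_2 mult_2_right)
  ultimately have "suz_theta e (trace4 A) = p * w + q * u + r * s"
    by (simp add: trace4_def suz_theta_add[OF char] minors)
  then show ?thesis
    unfolding trace
    by (simp add: vec_eq_iff forall_4 matrix_matrix_mult_def sum_4 mat_def N_entries
        algebra_simps self self' del: mult_2 mult_2_right)
qed

lemma eigenvectors_independent:
  fixes A :: "'k::field ^ 'n ^ 'n"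
  assumes "finite I" and eigen: "\<And>i. i \<in> I \<Longrightarrow> A *v v i = d i *s v i \<and> v i \<noteq> 0"
    and "inj_on d I" and "(\<Sum>i\<in>I. c i *s v i) = 0" and "i \<in> I"
  shows "c i = 0"
  using assms
proof (induction I arbitrary: c i rule: finite_induct)
  case (insert j I)
  have dist: "d i \<noteq> d j" if "i \<in> I" for i
    using insert.prems(2) insert.hyps(2) that by (auto simp: inj_on_def)
  have sum0: "c j *s v j + (\<Sum>i\<in>I. c i *s v i) = 0"
    using insert by simp
  have "A *v (c j *s v j + (\<Sum>i\<in>I. c i *s v i)) - d j *s (c j *s v j + (\<Sum>i\<in>I. c i *s v i))
      = (\<Sum>i\<in>I. (c i * (d i - d j)) *s v i)"
  proof -
    have "A *v (\<Sum>i\<in>I. c i *s v i) = (\<Sum>i\<in>I. (c i * d i) *s v i)"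
      unfolding vec.linear_sum[OF matrix_vector_mul_linear_gen]
      using insert.prems(1) by (intro sum.cong) (auto simp: vec.scale vector_scalar_commute[symmetric])
    moreover have "A *v (c j *s v j) = d j *s (c j *s v j)"
      using insert.prems(1)[of j] by (simp add: vec.scale mult.commute)
    moreover have "(\<Sum>i\<in>I. (c i * (d i - d j)) *s v i)
        = (\<Sum>i\<in>I. (c i * d i) *s v i) - d j *s (\<Sum>i\<in>I. c i *s v i)"
      by (simp add: vec.scale_sum_right sum_subtractf vec.scale_left_diff_distrib
          right_diff_distrib mult.commute)
    ultimately show ?thesis
      by (simp add: matrix_vector_right_distrib vec.scale_right_distrib)
  qed
  then have "(\<Sum>i\<in>I. (c i * (d i - d j)) *s v i) = 0"
    unfolding sum0 by simp
  then have "c i * (d i - d j) = 0" if "i \<in> I" for i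
    using insert.IH[of "\<lambda>i. c i * (d i - d j)" i] insert.prems(1,2) that by auto
  then have zero: "c i = 0" if "i \<in> I" for i
    using dist that by auto
  then have "c j *s v j = 0"
    using sum0 by simp
  then have "c j = 0"
    using insert.prems(1)[of j] by simp
  then show ?case
    using zero insert.prems(4) by auto
qed simp

section \<open>Eigenvectors\<close>

lemma eigenbasis_spans:
  fixes A :: "'k::field ^ 'n ^ 'n" and v :: "'n \<Rightarrow> 'k ^ 'n"
  assumes eigen: "\<And>i. A *v v i = d i *s v i" "\<And>i. v i \<noteq> 0" and "inj d"
  obtains c where "x = (\<Sum>i\<in>UNIV. c i *s v i)"
proof -
  define P :: "'k ^ 'n ^ 'n" where "P = (\<chi> r i. v i $ r)"
  have P: "P *v x = (\<Sum>i\<in>UNIV. x $ i *s v i)" for x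
    by (simp add: vec_eq_iff matrix_vector_mult_def P_def mult.commute)
  have "x = 0" if "P *v x = 0" for x
    using eigenvectors_independent[of UNIV A v d "\<lambda>i. x $ i"] that assms P by (simp add: vec_eq_iff)
  then have "\<exists>B. B ** P = mat 1"
    unfolding matrix_left_invertible_ker by blast
  then obtain B where "B ** P = mat 1"
    by blast
  then have PB: "P ** B = mat 1"
    by (simp only: matrix_left_right_inverse)
  have "x = P *v (B *v x)"
    by (simp only: matrix_vector_mul_assoc PB matrix_vector_mul_lid)
  then show thesis
    using that[of "\<lambda>i. (B *v x) $ i"] by (simp only: P)
qed

text \<open>
  The eigenvalues are distinct, so the eigenspaces of \<open>A\<close> are the lines spanned by the \<open>v i\<close>, and \<open>H\<close>
  preserves each of them.
\<close>

lemma commuting_matrix_scales_eigenbasis: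
  fixes A H :: "'k::field ^ 'n ^ 'n" and v :: "'n \<Rightarrow> 'k ^ 'n"
  assumes eigen: "\<And>i. A *v v i = d i *s v i" "\<And>i. v i \<noteq> 0" and inj: "inj d"
    and comm: "A ** H = H ** A"
  obtains b where "H *v v j = b *s v j"
proof -
  obtain c where c: "H *v v j = (\<Sum>i\<in>UNIV. c i *s v i)"
    using eigenbasis_spans[OF assms(1-3)] by blast
  have "A *v (H *v v j) = d j *s (H *v v j)"
    using comm eigen(1)[of j] by (metis matrix_vector_mul_assoc vec.scale)
  moreover have "A *v (\<Sum>i\<in>UNIV. c i *s v i) = (\<Sum>i\<in>UNIV. (c i * d i) *s v i)"
    unfolding vec.linear_sum[OF matrix_vector_mul_linear_gen]
    by (intro sum.cong) (auto simp: vec.scale eigen(1))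
  ultimately have "(\<Sum>i\<in>UNIV. (c i * (d i - d j)) *s v i) = 0"
    unfolding c by (simp add: vec.scale_sum_right sum_subtractf vec.scale_left_diff_distrib
          right_diff_distrib mult.commute)
  then have "c i * (d i - d j) = 0" for i
    using eigenvectors_independent[of UNIV A v d "\<lambda>i. c i * (d i - d j)" i] eigen inj by simp
  then have "c i = 0" if "i \<noteq> j" for i
    using inj that by (auto simp: inj_def)
  then have "(\<Sum>i\<in>UNIV. c i *s v i) = (\<Sum>i\<in>{j}. c i *s v i)"
    by (intro sum.mono_neutral_right) auto
  then show thesis
    using c by (intro that[of "c j"]) simp
qed

lemma suzuki_matrix_quadratic_vector:
  fixes A :: "'k::field ^ 4 ^ 4"
  assumes char: "CHAR('k) = 2" and A: "suzuki_matrix e A"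
  shows "(A + sadj A) *v ((A + sadj A) *v x)
    = trace4 A *s ((A + sadj A) *v x) + suz_theta e (trace4 A) *s x"
proof -
  have mat: "mat c *v y = c *s y" for c and y :: "'k ^ 4"
    by (simp add: vec_eq_iff forall_4 matrix_vector_mult_def mat_def sum_4)
  have "(A + sadj A) *v ((A + sadj A) *v x) = ((A + sadj A) ** (A + sadj A)) *v x"
    by (simp only: matrix_vector_mul_assoc)
  then show ?thesis
    unfolding suzuki_matrix_quadratic[OF assms]
    by (simp only: matrix_vector_mult_add_rdistrib mat matrix_vector_mul_assoc[symmetric])
qed

text \<open>
  The adjoint is the inverse of \<open>A\<close>, so \<open>A + sadj A\<close> acts on \<open>v\<close> as \<open>a + inverse a\<close>, and the quadratic
  relation for \<open>A + sadj A\<close> becomes an equation for \<open>a\<close>.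
\<close>

lemma suzuki_matrix_eigenvalue:
  fixes A :: "'k::field ^ 4 ^ 4"
  assumes char: "CHAR('k) = 2" and A: "suzuki_matrix e A" and v: "A *v v = a *s v" "v \<noteq> 0"
  shows "a \<noteq> 0" "suz_char (2 ^ (e + 1)) (trace4 A) a = 0"
proof -
  have "sadj A *v (A *v v) = v"
    using A by (simp add: suzuki_matrix_def matrix_vector_mul_assoc)
  then have inv: "a *s (sadj A *v v) = v"
    using v(1) by (simp add: vec.scale)
  then show "a \<noteq> 0"
    using v(2) by auto
  have "inverse a *s (a *s (sadj A *v v)) = inverse a *s v"
    by (simp only: inv)
  then have sadj: "sadj A *v v = inverse a *s v"
    using \<open>a \<noteq> 0\<close> by simp
  define u where "u = a + inverse a"
  have N: "(A + sadj A) *v v = u *s v"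
    by (simp add: matrix_vector_mult_add_rdistrib v(1) sadj u_def vec.scale_left_distrib)
  have "(u * u) *s v = (trace4 A * u + suz_theta e (trace4 A)) *s v"
    using suzuki_matrix_quadratic_vector[OF char A, of v]
    by (simp add: N vec.scale vec.scale_left_distrib)
  then have "u * u = trace4 A * u + suz_theta e (trace4 A)"
    using v(2) vec.scale_cancel_right by blast
  then have "u\<^sup>2 + trace4 A * u + suz_theta e (trace4 A)
      = (trace4 A * u + suz_theta e (trace4 A)) + (trace4 A * u + suz_theta e (trace4 A))"
    by (simp only: power2_eq_square add.assoc)
  then have "u\<^sup>2 + trace4 A * u + suz_theta e (trace4 A) = 0"
    by (simp only: add_self_CHAR_2[OF char])
  then show "suz_char (2 ^ (e + 1)) (trace4 A) a = 0"
    unfolding suz_char_altdef[OF char \<open>a \<noteq> 0\<close>] by (simp add: u_def suz_theta_def)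
qed

text \<open>
  Suppose that \<open>Y = A + a\<close> is injective. Then so is its adjoint. With \<open>N = A + sadj A\<close> and
  \<open>u = a + inverse a\<close> the product of \<open>Y\<close> and its adjoint is \<open>a (N + u)\<close>, and \<open>(N + u) (N + w) = 0\<close> for the
  other root \<open>w\<close> of the quadratic relation. Hence \<open>N\<close> is the scalar \<open>w\<close>, and the trace of \<open>A\<close>, which is
  the sum of two diagonal entries of \<open>N\<close>, vanishes.
\<close>

lemma suzuki_matrix_has_eigenvector:
  fixes A :: "'k::field ^ 4 ^ 4"
  assumes char: "CHAR('k) = 2" and A: "suzuki_matrix e A" and tr: "trace4 A \<noteq> 0"
    and root: "suz_char (2 ^ (e + 1)) (trace4 A) a = 0"
  obtains v where "A *v v = a *s v" "v \<noteq> 0"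
proof (rule ccontr)
  assume no: "\<not> thesis"
  note self = add_self_CHAR_2[OF char]
  have self': "x + x = 0" for x :: "'k ^ 4"
    by (simp only: vec_eq_iff vector_add_component zero_index self simp_thms)
  have "a \<noteq> 0"
    using root by auto
  define N where "N = A + sadj A"
  define u where "u = a + inverse a"
  define w where "w = trace4 A + u"
  define Y where "Y = A + mat a"
  have mat: "mat c *v y = c *s y" for c and y :: "'k ^ 4"
    by (simp add: vec_eq_iff forall_4 matrix_vector_mult_def mat_def sum_4)
  have "y = 0" if "Y *v y = 0" for y
  proof (rule ccontr)
    assume "y \<noteq> 0"
    have "A *v y + a *s y = 0"
      using that by (simp add: Y_def matrix_vector_mult_add_rdistrib mat)
    then have "A *v y = a *s y"
      using self'[of "a *s y"] by (metis add_right_cancel)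
    then show False
      using no that \<open>y \<noteq> 0\<close> \<open>\<And>v. A *v v = a *s v \<Longrightarrow> v \<noteq> 0 \<Longrightarrow> thesis\<close> by blast
  qed
  then have "\<exists>B. B ** Y = mat 1"
    unfolding matrix_left_invertible_ker by blast
  then obtain B where B: "B ** Y = mat 1"
    by blast
  have "sadj B ** sadj Y = mat 1"
  proof -
    have "sadj Y ** sadj B = mat 1"
      unfolding sadj_mult[symmetric] B by simp
    then show ?thesis
      by (simp only: matrix_left_right_inverse)
  qed
  then have cancel: "y = 0" if "Y *v (sadj Y *v y) = 0" for y
  proof -
    have "y = sadj B *v (sadj Y *v y)"
      by (simp only: matrix_vector_mul_assoc \<open>sadj B ** sadj Y = mat 1\<close> matrix_vector_mul_lid)
    also have "sadj Y *v y = B *v (Y *v (sadj Y *v y))"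
      by (simp only: matrix_vector_mul_assoc[of B] B matrix_vector_mul_lid)
    finally have "y = sadj B *v (B *v (Y *v (sadj Y *v y)))" .
    then show "y = 0"
      unfolding that by simp
  qed
  have YY: "Y *v (sadj Y *v y) = a *s (N *v y + u *s y)" for y
  proof -
    have "A *v (sadj A *v y) = y"
      using A by (simp add: suzuki_matrix_def matrix_vector_mul_assoc)
    moreover have "a * u = a * a + 1"
      using \<open>a \<noteq> 0\<close> by (simp add: u_def distrib_left)
    ultimately show ?thesis
      by (simp add: Y_def N_def sadj_add matrix_vector_mult_add_rdistrib matrix_vector_right_distrib mat
          vec.scale vec.scale_right_distrib vec.scale_left_distrib)
  qed
  have "suz_theta e (trace4 A) = u * w"
  proof -
    have "u\<^sup>2 + trace4 A * u + suz_theta e (trace4 A) = 0"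
      using root \<open>a \<noteq> 0\<close> unfolding suz_char_altdef[OF char \<open>a \<noteq> 0\<close>] by (simp add: u_def suz_theta_def)
    then have "u * w + suz_theta e (trace4 A) = 0"
      by (simp add: w_def power2_eq_square algebra_simps)
    then show ?thesis
      using eq_if_add_eq_0_CHAR_2[OF char] by metis
  qed
  then have quad: "N *v (N *v x) = trace4 A *s (N *v x) + (u * w) *s x" for x
    using suzuki_matrix_quadratic_vector[OF char A, of x] by (simp add: N_def)
  have "N *v x + w *s x = 0" for x
  proof (rule cancel)
    have "N *v (N *v x + w *s x) + u *s (N *v x + w *s x)
        = (trace4 A + w + u) *s (N *v x) + (u * w + u * w) *s x"
      by (simp only: matrix_vector_right_distrib quad vec.scale vec.scale_right_distrib
          vec.scale_left_distrib vec.scale_scale add_ac)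
    also have "trace4 A + w + u = (trace4 A + trace4 A) + (u + u)"
      by (simp only: w_def add_ac)
    also have "\<dots> *s (N *v x) + (u * w + u * w) *s x = 0"
      by (simp only: self) simp
    finally show "Y *v (sadj Y *v (N *v x + w *s x)) = 0"
      unfolding YY by simp
  qed
  then have N_scalar: "(N *v axis i 1) $ i + w = 0" for i
  proof -
    have "(N *v axis i 1 + w *s axis i 1) $ i = 0"
      using \<open>\<And>x. N *v x + w *s x = 0\<close> by simp
    then show ?thesis by (simp add: axis_def)
  qed
  have col: "(N *v axis i 1) $ i = N $ i $ i" for i
    by (simp add: matrix_vector_mult_def axis_def if_distrib[of "\<lambda>x. _ * x"] cong: if_cong)
  have "N $ 1 $ 1 = w" "N $ 2 $ 2 = w"
    using N_scalar eq_if_add_eq_0_CHAR_2[OF char] unfolding col by blast+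
  moreover have "trace4 A = N $ 1 $ 1 + N $ 2 $ 2"
    by (simp add: trace4_def N_def add_ac)
  ultimately show False
    using tr self by simp
qed

lemma matrix_mult_add_rdistrib: "((B :: 'k::semiring_1 ^ 'n ^ 'm) + C) ** A = B ** A + C ** A"
  by (simp add: vec_eq_iff matrix_matrix_mult_def distrib_right sum.distrib)

text \<open>
  The square of \<open>A + sadj A\<close> vanishes, which means that the square of \<open>A\<close> equals that of its inverse.
\<close>

lemma suzuki_matrix_trace_0:
  fixes A :: "'k::field ^ 4 ^ 4"
  assumes char: "CHAR('k) = 2" and A: "suzuki_matrix e A" and tr: "trace4 A = 0"
  shows "A ** A ** A ** A = mat 1"
proof -
  let ?B = "sadj A"
  have inv: "A ** ?B = mat 1" "?B ** A = mat 1"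
    using A by (simp_all add: suzuki_matrix_def)
  have "(A + ?B) ** (A + ?B) = 0"
    using suzuki_matrix_quadratic[OF char A] tr by simp
  then have "A ** A + ?B ** ?B + (mat 1 + mat 1) = 0"
    by (simp add: matrix_add_ldistrib matrix_mult_add_rdistrib inv add_ac)
  then have "A ** A = ?B ** ?B"
  proof -
    have self': "Z + Z = 0" for Z :: "'k ^ 4 ^ 4"
      by (simp only: vec_eq_iff vector_add_component zero_index add_self_CHAR_2[OF char] simp_thms)
    assume "A ** A + ?B ** ?B + (mat 1 + mat 1) = 0"
    then have "A ** A + ?B ** ?B = 0"
      by (simp only: self' add_0_right)
    then show ?thesis
      using self'[of "?B ** ?B"] by (metis add_right_cancel)
  qed
  then have "A ** A ** A ** A = ?B ** (?B ** A) ** A"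
    by (simp only: matrix_mul_assoc)
  then show ?thesis
    by (simp add: inv)
qed

lemma suzuki_matrix_eigenbasis:
  fixes A :: "'k::alg_closed_field ^ 4 ^ 4"
  assumes char: "CHAR('k) = 2" and r: "r = 2 ^ (e + 1)" and q: "q = 2 ^ (2 * e + 1)"
    and A: "suzuki_matrix e A" and tr: "trace4 A \<noteq> 0" "suz_theta e (suz_theta e (trace4 A)) = (trace4 A)\<^sup>2"
    and root: "suz_char r (trace4 A) a = 0"
  obtains v :: "4 \<Rightarrow> 'k ^ 4" and d :: "4 \<Rightarrow> 'k" and N where "\<And>i. A *v v i = d i *s v i" "\<And>i. v i \<noteq> 0" "inj d"
    "N \<in> {q - 1, q + r + 1, q - r + 1}" "\<And>i. d i ^ N = 1"
proof -
  have r': "r = 2 ^ Suc e" and tr_square: "(trace4 A ^ r) ^ r = (trace4 A)\<^sup>2"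
    using r tr(2) by (simp_all add: suz_theta_def)
  obtain b N where b: "distinct [a, inverse a, b, inverse b]"
    "suz_char r (trace4 A) (inverse a) = 0" "suz_char r (trace4 A) b = 0"
    "suz_char r (trace4 A) (inverse b) = 0"
    and N: "N \<in> {q - 1, q + r + 1, q - r + 1}" "a ^ N = 1" "b ^ N = 1"
    using suz_char_roots[OF char r' q tr(1) tr_square root] by blast
  define d :: "4 \<Rightarrow> 'k" where "d i = vector [a, inverse a, b, inverse b] $ i" for i
  have d: "d 1 = a" "d 2 = inverse a" "d 3 = b" "d 4 = inverse b"
    by (simp_all add: d_def)
  have "\<forall>i j. d i = d j \<longrightarrow> i = j"
    unfolding forall_4 d using b(1) by auto
  then have "inj d"
    by (auto simp: inj_def)
  have "\<forall>i. suz_char r (trace4 A) (d i) = 0"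
    unfolding forall_4 d using b root by simp
  then have "\<forall>i. \<exists>v. A *v v = d i *s v \<and> v \<noteq> 0"
    using suzuki_matrix_has_eigenvector[OF char A tr(1)] r by metis
  then obtain v where v: "\<And>i. A *v v i = d i *s v i \<and> v i \<noteq> 0"
    by metis
  have "\<forall>i. d i ^ N = 1"
    unfolding forall_4 d using N by (simp add: power_inverse)
  then have dN: "d i ^ N = 1" for i
    by blast
  show thesis
  proof (rule that[of v d N])
    show "A *v v i = d i *s v i" "v i \<noteq> 0" for i
      using v by blast+
  qed (fact \<open>inj d\<close> N(1) dN)+
qed

section \<open>The Suzuki group\<close>

lemma group_GL4: "group (GL4 :: ('a::field ^ 4 ^ 4) monoid)"
proof (rule groupI)
  fix x y z :: "'a ^ 4 ^ 4"
  assume x: "x \<in> carrier GL4"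
  show "\<exists>y\<in>carrier GL4. y \<otimes>\<^bsub>GL4\<^esub> x = \<one>\<^bsub>GL4\<^esub>"
    using x by (auto simp: GL4_def invertible_def)
  assume y: "y \<in> carrier GL4"
  show "x \<otimes>\<^bsub>GL4\<^esub> y \<in> carrier GL4"
    using x y by (simp add: GL4_def invertible_mult)
qed (simp_all add: GL4_def matrix_mul_assoc invertible_def)

definition ac_matrix :: "'a::field ^ 4 ^ 4 \<Rightarrow> 'a alg_closure ^ 4 ^ 4" where
  "ac_matrix = map_matrix to_ac"

lemma ac_matrix_nth [simp]: "ac_matrix A $ i $ j = to_ac (A $ i $ j)"
  by (simp add: ac_matrix_def)

lemma ac_matrix_mult: "ac_matrix (A ** B) = ac_matrix A ** ac_matrix B"
  by (simp add: vec_eq_iff matrix_matrix_mult_def to_ac_sum)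

lemma ac_matrix_one [simp]: "ac_matrix (mat 1) = mat 1"
  by (simp add: vec_eq_iff mat_def)

lemma ac_matrix_eq_iff [simp]: "ac_matrix A = ac_matrix B \<longleftrightarrow> A = B"
  by (simp add: vec_eq_iff)

lemma ac_matrix_sadj: "ac_matrix (sadj A) = sadj (ac_matrix A)"
  by (simp add: vec_eq_iff)

lemma trace4_ac_matrix: "trace4 (ac_matrix A) = to_ac (trace4 A)"
  by (simp add: trace4_def)

lemma suzuki_matrix_ac_matrix:
  assumes "suzuki_matrix e A"
  shows "suzuki_matrix e (ac_matrix A)"
  unfolding suzuki_matrix_def
proof (intro conjI allI)
  have "A ** sadj A = mat 1" "sadj A ** A = mat 1"
    using assms by (simp_all add: suzuki_matrix_def)
  then show "ac_matrix A ** sadj (ac_matrix A) = mat 1" "sadj (ac_matrix A) ** ac_matrix A = mat 1"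
    by (simp_all flip: ac_matrix_sadj ac_matrix_mult)
  fix i j
  have "suz_theta e (A $ i $ j) = minor2 A (ix1 i) (ix2 i) (ix1 j) (ix2 j)"
    using assms by (simp add: suzuki_matrix_def)
  then have "to_ac (suz_theta e (A $ i $ j)) = to_ac (minor2 A (ix1 i) (ix2 i) (ix1 j) (ix2 j))"
    by simp
  then show "suz_theta e (ac_matrix A $ i $ j) = minor2 (ac_matrix A) (ix1 i) (ix2 i) (ix1 j) (ix2 j)"
    by (simp add: suz_theta_def minor2_def)
qed

text \<open>
  The \<open>n\<close> distinct powers of \<open>c\<close> are all the roots of \<open>x ^ n - 1\<close>.
\<close>

lemma root_of_unity_is_power:
  fixes b c :: "'k::field"
  assumes "n > 0" and c: "\<And>k. c ^ k = 1 \<longleftrightarrow> n dvd k" and b: "b ^ n = 1"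
  obtains k where "b = c ^ k"
proof -
  define p :: "'k poly" where "p = Polynomial.monom 1 n - 1"
  have coeff: "Polynomial.coeff p n = 1"
    using \<open>n > 0\<close> by (simp add: p_def)
  then have "p \<noteq> 0" by auto
  have roots: "{x. poly p x = 0} = {x. x ^ n = 1}"
    by (simp add: p_def poly_monom)
  have "Polynomial.degree p \<le> n"
    unfolding p_def by (intro degree_diff_le) (simp_all add: degree_monom_eq)
  then have card_roots: "card {x :: 'k. x ^ n = 1} \<le> n"
    using card_poly_roots_bound[OF \<open>p \<noteq> 0\<close>] unfolding roots by linarith
  have "c \<noteq> 0"
    using c[of n] \<open>n > 0\<close> by (auto simp: power_0_left)
  have inj: "inj_on (\<lambda>k. c ^ k) {..<n}"
  proof (rule linorder_inj_onI)
    fix i j :: nat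
    assume ij: "i < j" "i \<in> {..<n}" "j \<in> {..<n}"
    show "c ^ i \<noteq> c ^ j"
    proof
      assume "c ^ i = c ^ j"
      then have "c ^ (j - i) = 1"
        using ij(1) \<open>c \<noteq> 0\<close> by (simp add: power_diff)
      then have "n dvd j - i" using c by blast
      then show False using ij by (auto dest: dvd_imp_le)
    qed
  qed auto
  have "(\<lambda>k. c ^ k) ` {..<n} = {x. x ^ n = 1}"
  proof (rule card_seteq)
    show "finite {x :: 'k. x ^ n = 1}"
      using poly_roots_finite[OF \<open>p \<noteq> 0\<close>] unfolding roots .
    have "(c ^ k) ^ n = 1" for k
      using c[of "k * n"] by (simp flip: power_mult)
    then show "(\<lambda>k. c ^ k) ` {..<n} \<subseteq> {x. x ^ n = 1}"
      by auto
    show "card {x :: 'k. x ^ n = 1} \<le> card ((\<lambda>k. c ^ k) ` {..<n})"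
      using card_roots inj by (simp add: card_image)
  qed
  then show thesis
    using that b by blast
qed

locale suzuki =
  fixes e q r :: nat and G :: "('a::{field,finite} ^ 4 ^ 4) monoid"
  assumes q: "q = 2 ^ (2 * e + 1)" and r: "r = 2 ^ (e + 1)" and card_field: "CARD('a) = q"
  defines "G \<equiv> suzuki_group e"
begin

lemma char: "CHAR('a) = 2"
  using CHAR_eq_2_if_CARD_two_power card_field q by blast

lemma char_ac: "CHAR('a alg_closure) = 2"
  using char by simp

lemma power_q: "(x :: 'a) ^ q = x"
  using power_CARD_eq_self[of x] card_field by simp

lemma suz_theta_suz_theta: "suz_theta e (suz_theta e (x :: 'a)) = x\<^sup>2"
proof -
  have "suz_theta e (suz_theta e x) = x ^ (r * r)"
    unfolding suz_theta_def r by (simp only: power_mult)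
  also have "r * r = q * 2"
    using suz_parameters(1)[of r e q] r q by simp
  finally show ?thesis
    by (simp add: power_mult power_q)
qed

lemma generators_suzuki_matrix:
  assumes "g \<in> {suz_S e a b |a b. True} \<union> {suz_M e c |c. c \<noteq> 0} \<union> {suz_T :: 'a ^ 4 ^ 4}"
  shows "suzuki_matrix e g"
  using assms suzuki_matrix_suz_T suzuki_matrix_suz_M power_q[unfolded q]
    suzuki_matrix_suz_S[OF char suz_theta_suz_theta suz_theta_suz_theta] by auto

lemma suzuki_matrix_in_GL4: "suzuki_matrix e A \<Longrightarrow> A \<in> carrier GL4"
  by (auto simp: GL4_def suzuki_matrix_def invertible_def)

lemma suzuki_matrix_if_in_G:
  assumes "g \<in> carrier G"
  shows "suzuki_matrix e g"
proof -
  interpret GL: group "GL4 :: ('a ^ 4 ^ 4) monoid"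
    by (rule group_GL4)
  have "g \<in> generate GL4 ({suz_S e a b |a b. True} \<union> {suz_M e c |c. c \<noteq> 0} \<union> {suz_T})"
    using assms by (simp add: G_def suzuki_group_def)
  then show ?thesis
  proof (induction rule: generate.induct)
    case one
    then show ?case by (simp add: GL4_def suzuki_matrix_one)
  next
    case (incl h)
    then show ?case by (rule generators_suzuki_matrix)
  next
    case (inv h)
    then have h: "suzuki_matrix e h" by (rule generators_suzuki_matrix)
    have "inv\<^bsub>GL4\<^esub> h = sadj h"
    proof (rule GL.inv_equality)
      show "sadj h \<otimes>\<^bsub>GL4\<^esub> h = \<one>\<^bsub>GL4\<^esub>"
        using h by (simp add: suzuki_matrix_def GL4_def)
      show "h \<in> carrier GL4" "sadj h \<in> carrier GL4"
        using h suzuki_matrix_sadj suzuki_matrix_in_GL4 by blast+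
    qed
    then show ?case
      using suzuki_matrix_sadj[OF h] by simp
  next
    case (eng h1 h2)
    then show ?case
      using suzuki_matrix_mult[OF char] by (simp add: GL4_def)
  qed
qed

sublocale group G
proof -
  interpret GL: group "GL4 :: ('a ^ 4 ^ 4) monoid"
    by (rule group_GL4)
  have "{suz_S e a b |a b. True} \<union> {suz_M e c |c. c \<noteq> 0} \<union> {suz_T :: 'a ^ 4 ^ 4} \<subseteq> carrier GL4"
    using generators_suzuki_matrix suzuki_matrix_in_GL4 by blast
  from GL.subgroup_imp_group[OF GL.generate_is_subgroup[OF this]] show "group G"
    by (simp add: G_def suzuki_group_def)
qed

lemma G_simps [simp]: "x \<otimes>\<^bsub>G\<^esub> y = x ** y" "\<one>\<^bsub>G\<^esub> = mat 1"
  by (simp_all add: G_def suzuki_group_def GL4_def)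

lemma finite_G: "finite (carrier G)"
  by simp

lemma pow_eigenvector:
  assumes "ac_matrix g *v v = a *s v"
  shows "ac_matrix (g [^]\<^bsub>G\<^esub> (n::nat)) *v v = a ^ n *s v"
proof (induction n)
  case (Suc n)
  have "ac_matrix (g [^]\<^bsub>G\<^esub> Suc n) *v v = ac_matrix (g [^]\<^bsub>G\<^esub> n) *v (ac_matrix g *v v)"
    by (simp only: nat_pow_Suc G_simps ac_matrix_mult matrix_vector_mul_assoc)
  then show ?case
    by (simp only: assms vec.scale Suc vec.scale_scale power_Suc)
qed (simp only: nat_pow_0 G_simps ac_matrix_one matrix_vector_mul_lid power_0 vec.scale_one)

lemma pow4_if_trace_0:
  assumes "g \<in> carrier G" "trace4 g = 0"
  shows "g [^]\<^bsub>G\<^esub> (4::nat) = \<one>\<^bsub>G\<^esub>"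
  using suzuki_matrix_trace_0[OF char suzuki_matrix_if_in_G[OF assms(1)] assms(2)]
  by (simp add: eval_nat_numeral)

lemma trace_theta:
  "suz_theta e (suz_theta e (trace4 (ac_matrix (g :: 'a ^ 4 ^ 4)))) = (trace4 (ac_matrix g))\<^sup>2"
proof -
  have "to_ac (suz_theta e (suz_theta e (trace4 g))) = to_ac ((trace4 g)\<^sup>2)"
    by (simp only: suz_theta_suz_theta)
  then show ?thesis
    by (simp add: suz_theta_def trace4_ac_matrix)
qed

lemma eigenvalue_1_imp_trace_0:
  assumes "g \<in> carrier G" "ac_matrix g *v v = v" "v \<noteq> 0"
  shows "trace4 g = 0"
proof -
  note self = add_self_CHAR_2[OF char_ac]
  have "suz_char r (trace4 (ac_matrix g)) 1 = 0"
    using suzuki_matrix_eigenvalue(2)[OF char_ac suzuki_matrix_ac_matrix[OF suzuki_matrix_if_in_G[OF assms(1)]], of v 1]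
      assms(2,3) r by simp
  moreover have "suz_char r (trace4 (ac_matrix g)) 1
      = (1 + 1) + (trace4 (ac_matrix g) + trace4 (ac_matrix g)) + trace4 (ac_matrix g) ^ r"
    by (simp add: suz_char_def)
  ultimately have "trace4 (ac_matrix g) ^ r = 0"
    by (simp only: self add_0_left)
  then show ?thesis
    by (simp add: trace4_ac_matrix)
qed

lemma eigenbasis:
  assumes "g \<in> carrier G" "trace4 g \<noteq> 0"
  obtains v :: "4 \<Rightarrow> 'a alg_closure ^ 4" and d :: "4 \<Rightarrow> 'a alg_closure" and N where "\<And>i. ac_matrix g *v v i = d i *s v i" "\<And>i. v i \<noteq> 0" "inj d"
    "N \<in> {q - 1, q + r + 1, q - r + 1}" "\<And>i. d i ^ N = 1"
proof -
  let ?t = "trace4 (ac_matrix g)"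
  have "\<exists>x. poly [:1, ?t, ?t ^ r, ?t, 1:] x = 0"
    by (rule alg_closed_imp_poly_has_root) simp
  then obtain a where "poly [:1, ?t, ?t ^ r, ?t, 1:] a = 0"
    by blast
  then have root: "suz_char r ?t a = 0"
    by (simp add: suz_char_def algebra_simps power2_eq_square power3_eq_cube power4_eq_xxxx)
  have "?t \<noteq> 0"
    using assms(2) by (simp add: trace4_ac_matrix)
  from suzuki_matrix_eigenbasis[OF char_ac r q suzuki_matrix_ac_matrix[OF suzuki_matrix_if_in_G[OF assms(1)]]
      this trace_theta root]
  show thesis
    using that by blast
qed

lemma pow_eq_one_if_trace_nonzero:
  assumes "g \<in> carrier G" "trace4 g \<noteq> 0"
  shows "\<exists>N\<in>{q - 1, q + r + 1, q - r + 1}. g [^]\<^bsub>G\<^esub> N = \<one>\<^bsub>G\<^esub>"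
proof -
  obtain v :: "4 \<Rightarrow> 'a alg_closure ^ 4" and d :: "4 \<Rightarrow> 'a alg_closure" and N
    where v: "\<And>i. ac_matrix g *v v i = d i *s v i" "\<And>i. v i \<noteq> 0" "inj d"
    and N: "N \<in> {q - 1, q + r + 1, q - r + 1}" "\<And>i. d i ^ N = 1"
    using eigenbasis[OF assms] by blast
  have fixed: "ac_matrix (g [^]\<^bsub>G\<^esub> N) *v v i = v i" for i
    using pow_eigenvector[OF v(1)] N(2) by simp
  have "ac_matrix (g [^]\<^bsub>G\<^esub> N) *v x = mat 1 *v x" for x
  proof -
    obtain c where c: "x = (\<Sum>i\<in>UNIV. c i *s v i)"
      using eigenbasis_spans[OF v] by blast
    show ?thesis
      unfolding c vec.linear_sum[OF matrix_vector_mul_linear_gen] matrix_vector_mul_lid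
      by (intro sum.cong refl) (simp only: vec.scale fixed)
  qed
  then have "ac_matrix (g [^]\<^bsub>G\<^esub> N) = ac_matrix (mat 1)"
    unfolding matrix_eq ac_matrix_one by blast
  then have "g [^]\<^bsub>G\<^esub> N = \<one>\<^bsub>G\<^esub>"
    by (simp only: ac_matrix_eq_iff G_simps)
  then show ?thesis
    using N(1) by blast
qed

lemma orders_odd: "N \<in> {q - 1, q + r + 1, q - r + 1} \<Longrightarrow> odd N"
  using suz_parameters[of r e q] r q by auto

text \<open>
  As 1 is an eigenvalue of \<open>h\<close>, the trace of \<open>h\<close> vanishes and \<open>h\<^sup>4 = 1\<close>. On the other hand \<open>g h\<close> has the
  same eigenvalue \<open>a \<noteq> 1\<close> on \<open>v\<close> as \<open>g\<close>, so \<open>g\<close> and \<open>g h\<close> have odd order. They commute, so the order of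
  \<open>h\<close> is odd, too.
\<close>

lemma commuting_fixing_eigenvector_eq_one:
  assumes g: "g \<in> carrier G" "trace4 g \<noteq> 0" "ac_matrix g *v v = a *s v" "v \<noteq> 0"
    and h: "h \<in> carrier G" "g \<otimes>\<^bsub>G\<^esub> h = h \<otimes>\<^bsub>G\<^esub> g" "ac_matrix h *v v = v"
  shows "h = \<one>\<^bsub>G\<^esub>"
proof -
  have h4: "h [^]\<^bsub>G\<^esub> (4::nat) = \<one>\<^bsub>G\<^esub>"
    using pow4_if_trace_0 eigenvalue_1_imp_trace_0 h(1,3) g(4) by blast
  have "a \<noteq> 1"
    using eigenvalue_1_imp_trace_0[OF g(1) _ g(4)] g(2,3) by auto
  have gh: "g \<otimes>\<^bsub>G\<^esub> h \<in> carrier G"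
    using g(1) h(1) by (rule m_closed)
  have gh_v: "ac_matrix (g \<otimes>\<^bsub>G\<^esub> h) *v v = a *s v"
    by (simp only: G_simps ac_matrix_mult matrix_vector_mul_assoc[symmetric] h(3) g(3))
  have "trace4 (g \<otimes>\<^bsub>G\<^esub> h) \<noteq> 0"
  proof
    assume "trace4 (g \<otimes>\<^bsub>G\<^esub> h) = 0"
    then have "(g \<otimes>\<^bsub>G\<^esub> h) [^]\<^bsub>G\<^esub> (4::nat) = \<one>\<^bsub>G\<^esub>"
      by (rule pow4_if_trace_0[OF gh])
    then have "a ^ 4 *s v = 1 *s v"
      using pow_eigenvector[OF gh_v, of 4] by (simp del: G_simps(1))
    then have "a ^ 4 = 1"
      using g(4) vec.scale_cancel_right by blast
    then show False
      using power_two_power_inj[OF char_ac, of a 2 1] \<open>a \<noteq> 1\<close> by simp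
  qed
  then obtain N :: nat where N: "odd N" "(g \<otimes>\<^bsub>G\<^esub> h) [^]\<^bsub>G\<^esub> N = \<one>\<^bsub>G\<^esub>"
    using pow_eq_one_if_trace_nonzero[OF gh] orders_odd by blast
  obtain M :: nat where M: "odd M" "g [^]\<^bsub>G\<^esub> M = \<one>\<^bsub>G\<^esub>"
    using pow_eq_one_if_trace_nonzero[OF g(1,2)] orders_odd by blast
  have "((g \<otimes>\<^bsub>G\<^esub> h) [^]\<^bsub>G\<^esub> N) [^]\<^bsub>G\<^esub> M = ((g [^]\<^bsub>G\<^esub> M) [^]\<^bsub>G\<^esub> N) \<otimes>\<^bsub>G\<^esub> (h [^]\<^bsub>G\<^esub> (N * M))"
    using pow_mult_distrib[OF h(2) g(1) h(1), of "N * M"] g(1) h(1) gh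
    by (simp add: nat_pow_pow mult.commute del: G_simps)
  then have "h [^]\<^bsub>G\<^esub> (N * M) = \<one>\<^bsub>G\<^esub>"
    unfolding N(2) M(2) using h(1) by (simp del: G_simps)
  moreover have "coprime 4 (N * M)"
    using N(1) M(1) coprime_power_left_iff[of 2 2 "N * M"] by simp
  ultimately show ?thesis
    using eq_one_if_coprime_pows[OF h(1) h4] by blast
qed

text \<open>
  In other words, the centralizer of \<open>g\<close> acts on \<open>v\<close> by a faithful character. The inverse of \<open>k\<close> is
  written as a power of \<open>k\<close> with natural exponent, so that its action on \<open>v\<close> is known.
\<close>

lemma commuting_eq_if_same_eigenvalue:
  assumes g: "g \<in> carrier G" "trace4 g \<noteq> 0" "ac_matrix g *v v = a *s v" "v \<noteq> 0"
    and h: "h \<in> carrier G" "g \<otimes>\<^bsub>G\<^esub> h = h \<otimes>\<^bsub>G\<^esub> g" "ac_matrix h *v v = b *s v"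
    and k: "k \<in> carrier G" "g \<otimes>\<^bsub>G\<^esub> k = k \<otimes>\<^bsub>G\<^esub> g" "ac_matrix k *v v = b *s v"
  shows "h = k"
proof -
  define n where "n = ord k - 1"
  have n: "Suc n = ord k"
    using ord_ge_1[OF finite_G k(1)] by (simp add: n_def)
  have kn: "k [^]\<^bsub>G\<^esub> n \<in> carrier G"
    using k(1) by (rule nat_pow_closed)
  have comm_kn: "g \<otimes>\<^bsub>G\<^esub> k [^]\<^bsub>G\<^esub> n = k [^]\<^bsub>G\<^esub> n \<otimes>\<^bsub>G\<^esub> g"
    by (induction n) (use g(1) k in \<open>simp_all del: G_simps add: m_assoc[symmetric]\<close>, simp_all del: G_simps add: m_assoc)
  have k_ord: "k \<otimes>\<^bsub>G\<^esub> k [^]\<^bsub>G\<^esub> n = \<one>\<^bsub>G\<^esub>"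
    using pow_ord_eq_1[OF k(1)] unfolding n[symmetric] nat_pow_Suc2[OF k(1)] .
  have "h \<otimes>\<^bsub>G\<^esub> k [^]\<^bsub>G\<^esub> n = \<one>\<^bsub>G\<^esub>"
  proof (rule commuting_fixing_eigenvector_eq_one[OF g])
    show "h \<otimes>\<^bsub>G\<^esub> k [^]\<^bsub>G\<^esub> n \<in> carrier G"
      using h(1) kn by (rule m_closed)
    show "g \<otimes>\<^bsub>G\<^esub> (h \<otimes>\<^bsub>G\<^esub> k [^]\<^bsub>G\<^esub> n) = (h \<otimes>\<^bsub>G\<^esub> k [^]\<^bsub>G\<^esub> n) \<otimes>\<^bsub>G\<^esub> g"
      using g(1) h(1,2) kn comm_kn by (metis m_assoc)
    have "ac_matrix (h \<otimes>\<^bsub>G\<^esub> k [^]\<^bsub>G\<^esub> n) *v v = ac_matrix h *v (b ^ n *s v)"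
      by (simp only: G_simps ac_matrix_mult matrix_vector_mul_assoc[symmetric] pow_eigenvector[OF k(3)])
    also have "\<dots> = ac_matrix k *v (b ^ n *s v)"
      by (simp only: vec.scale h(3) k(3))
    also have "\<dots> = ac_matrix (k \<otimes>\<^bsub>G\<^esub> k [^]\<^bsub>G\<^esub> n) *v v"
      by (simp only: G_simps ac_matrix_mult matrix_vector_mul_assoc[symmetric] pow_eigenvector[OF k(3)])
    also have "\<dots> = v"
      unfolding k_ord by simp
    finally show "ac_matrix (h \<otimes>\<^bsub>G\<^esub> k [^]\<^bsub>G\<^esub> n) *v v = v" .
  qed
  then show ?thesis
    using k_ord right_cancel[OF kn h(1) k(1)] by metis
qed

lemma common_eigenvector:
  assumes "g \<in> carrier G" "g [^]\<^bsub>G\<^esub> (4::nat) \<noteq> \<one>\<^bsub>G\<^esub>"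
  obtains v a where "trace4 g \<noteq> 0" "ac_matrix g *v v = a *s v" "v \<noteq> 0"
    "\<And>h. h \<in> carrier G \<Longrightarrow> g \<otimes>\<^bsub>G\<^esub> h = h \<otimes>\<^bsub>G\<^esub> g \<Longrightarrow> \<exists>b. ac_matrix h *v v = b *s v"
proof -
  have tr: "trace4 g \<noteq> 0"
    using pow4_if_trace_0 assms by blast
  obtain v :: "4 \<Rightarrow> 'a alg_closure ^ 4" and d :: "4 \<Rightarrow> 'a alg_closure"
    and N where v: "\<And>i. ac_matrix g *v v i = d i *s v i" "\<And>i. v i \<noteq> 0" "inj d"
      and "N \<in> {q - 1, q + r + 1, q - r + 1}" "\<And>i. d i ^ N = 1"
    using eigenbasis[OF assms(1) tr] by blast
  show thesis
  proof (rule that[OF tr v(1,2)])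
    fix h assume "g \<otimes>\<^bsub>G\<^esub> h = h \<otimes>\<^bsub>G\<^esub> g"
    then have "ac_matrix g ** ac_matrix h = ac_matrix h ** ac_matrix g"
      by (simp flip: ac_matrix_mult)
    then show "\<exists>b. ac_matrix h *v v 1 = b *s v 1"
      using commuting_matrix_scales_eigenbasis[OF v] by metis
  qed
qed

lemma commute_trans:
  assumes "x \<in> carrier G" "y \<in> carrier G" "z \<in> carrier G" "x [^]\<^bsub>G\<^esub> (4::nat) \<noteq> \<one>\<^bsub>G\<^esub>"
    and xy: "x \<otimes>\<^bsub>G\<^esub> y = y \<otimes>\<^bsub>G\<^esub> x" and xz: "x \<otimes>\<^bsub>G\<^esub> z = z \<otimes>\<^bsub>G\<^esub> x"
  shows "y \<otimes>\<^bsub>G\<^esub> z = z \<otimes>\<^bsub>G\<^esub> y"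
proof -
  obtain v a where v: "trace4 x \<noteq> 0" "ac_matrix x *v v = a *s v" "v \<noteq> 0"
    and scale: "\<And>h. h \<in> carrier G \<Longrightarrow> x \<otimes>\<^bsub>G\<^esub> h = h \<otimes>\<^bsub>G\<^esub> x \<Longrightarrow> \<exists>b. ac_matrix h *v v = b *s v"
    using common_eigenvector[OF assms(1,4)] by blast
  obtain b c where b: "ac_matrix y *v v = b *s v" and c: "ac_matrix z *v v = c *s v"
    using scale assms by blast
  show ?thesis
  proof (rule commuting_eq_if_same_eigenvalue[OF assms(1) v])
    show "y \<otimes>\<^bsub>G\<^esub> z \<in> carrier G" "z \<otimes>\<^bsub>G\<^esub> y \<in> carrier G"
      using assms by (auto simp del: G_simps)
    show "x \<otimes>\<^bsub>G\<^esub> (y \<otimes>\<^bsub>G\<^esub> z) = y \<otimes>\<^bsub>G\<^esub> z \<otimes>\<^bsub>G\<^esub> x" "x \<otimes>\<^bsub>G\<^esub> (z \<otimes>\<^bsub>G\<^esub> y) = z \<otimes>\<^bsub>G\<^esub> y \<otimes>\<^bsub>G\<^esub> x"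
      using assms(1-3) xy xz by (metis m_assoc)+
    show "ac_matrix (y \<otimes>\<^bsub>G\<^esub> z) *v v = (b * c) *s v" "ac_matrix (z \<otimes>\<^bsub>G\<^esub> y) *v v = (b * c) *s v"
      by (simp_all only: G_simps ac_matrix_mult matrix_vector_mul_assoc[symmetric] b c vec.scale
          vec.scale_scale mult.commute)
  qed
qed

text \<open>
  Under the faithful character of the centralizer of \<open>z\<close>, the element \<open>z\<close> goes to a primitive root of
  unity of order \<open>ord z\<close> and \<open>y\<close> to some root of unity of that order, which is a power of the former.
\<close>

lemma power_of_if_ord_dvd:
  assumes "y \<in> carrier G" "z \<in> carrier G" "z [^]\<^bsub>G\<^esub> (4::nat) \<noteq> \<one>\<^bsub>G\<^esub>"
    and yz: "y \<otimes>\<^bsub>G\<^esub> z = z \<otimes>\<^bsub>G\<^esub> y" and "ord y dvd ord z"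
  shows "power_of G y z"
proof -
  obtain v c where v: "trace4 z \<noteq> 0" "ac_matrix z *v v = c *s v" "v \<noteq> 0"
    and scale: "\<And>h. h \<in> carrier G \<Longrightarrow> z \<otimes>\<^bsub>G\<^esub> h = h \<otimes>\<^bsub>G\<^esub> z \<Longrightarrow> \<exists>b. ac_matrix h *v v = b *s v"
    using common_eigenvector[OF assms(2,3)] by blast
  obtain b where b: "ac_matrix y *v v = b *s v"
    using scale[OF assms(1) yz[symmetric]] by blast
  have unit: "x ^ n = 1" if "ac_matrix g *v v = x *s v" "g [^]\<^bsub>G\<^esub> n = \<one>\<^bsub>G\<^esub>" for x g and n :: nat
  proof -
    have "x ^ n *s v = 1 *s v"
      using pow_eigenvector[OF that(1), of n] unfolding that(2) by simp
    then show ?thesis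
      using v(3) vec.scale_cancel_right by blast
  qed
  have comm: "z \<otimes>\<^bsub>G\<^esub> z [^]\<^bsub>G\<^esub> k = z [^]\<^bsub>G\<^esub> k \<otimes>\<^bsub>G\<^esub> z" for k :: nat
    using assms(2) by (metis nat_pow_Suc nat_pow_Suc2)
  have c_order: "c ^ k = 1 \<longleftrightarrow> ord z dvd k" for k
  proof
    assume "c ^ k = 1"
    then have "ac_matrix (z [^]\<^bsub>G\<^esub> k) *v v = v"
      using pow_eigenvector[OF v(2), of k] by simp
    then have "z [^]\<^bsub>G\<^esub> k = \<one>\<^bsub>G\<^esub>"
      using commuting_fixing_eigenvector_eq_one[OF assms(2) v nat_pow_closed[OF assms(2)] comm] by blast
    then show "ord z dvd k"
      using pow_eq_id[OF assms(2)] by blast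
  next
    assume "ord z dvd k"
    then show "c ^ k = 1"
      using unit[OF v(2)] pow_eq_id[OF assms(2)] by blast
  qed
  moreover have "ord z > 0"
    using ord_ge_1[OF finite_G assms(2)] by simp
  moreover have "b ^ ord z = 1"
    using unit[OF b] pow_eq_id[OF assms(1)] assms(5) by blast
  ultimately obtain k where "b = c ^ k"
    using root_of_unity_is_power by metis
  then have "y = z [^]\<^bsub>G\<^esub> k"
    using commuting_eq_if_same_eigenvalue[OF assms(2) v assms(1) yz[symmetric] b
        nat_pow_closed[OF assms(2)] comm] pow_eigenvector[OF v(2)] by blast
  then show ?thesis
    unfolding power_of_def by blast
qed

text \<open>
  A primitive \<open>N\<close>-th root of unity \<open>\<alpha>\<close> is an eigenvalue of an element \<open>g\<close> with a suitable trace. A power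
  of \<open>g\<close> commutes with \<open>g\<close>, so it is trivial as soon as it fixes an eigenvector for \<open>\<alpha>\<close>. Therefore
  \<open>g\<close> has the same order as \<open>\<alpha>\<close>.
\<close>

lemma exists_element_of_order:
  assumes N: "N \<in> {q - 1, q + r + 1, q - r + 1}" "N > 1"
  shows "\<exists>x\<in>carrier G. ord x = N"
proof -
  have "of_nat N \<noteq> (0 :: 'a alg_closure)"
    using orders_odd[OF N(1)] char_ac by (simp add: of_nat_eq_0_iff_char_dvd)
  then obtain \<alpha> :: "'a alg_closure" where \<alpha>: "\<And>n. \<alpha> ^ n = 1 \<longleftrightarrow> N dvd n"
    using exists_primitive_root_of_unity by blast
  have r': "r = 2 ^ Suc e" using r by simp
  have "\<alpha> ^ N = 1"
    by (simp only: \<alpha> dvd_refl)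
  then obtain \<tau> where \<tau>: "\<tau> ^ q = \<tau>" "suz_char r \<tau> \<alpha> = 0"
    by (rule suz_char_has_root_of_unity[OF char_ac r' q N(1)])
  have "\<tau> \<in> range to_ac"
    using \<tau>(1) range_to_ac_eq[where 'a = 'a] card_field by simp
  then obtain t where t: "\<tau> = to_ac t" by blast
  have "\<tau> \<noteq> 0"
  proof
    assume "\<tau> = 0"
    then have "\<alpha> ^ 4 + 1 = 0"
      using \<tau>(2) r by (simp add: suz_char_def power_0_left)
    then have "N dvd 4"
      using \<alpha>[of 4] eq_if_add_eq_0_CHAR_2[OF char_ac] by blast
    moreover have "coprime N 4"
      using orders_odd[OF N(1)] coprime_power_right_iff[of N 2 2] by simp
    ultimately show False
      using N(2) by (metis coprime_common_divisor_nat dvd_refl less_irrefl)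
  qed
  \<comment> \<open>The trace of \<open>suz_T ** suz_S e 0 c\<close> is \<open>suz_theta e c\<close>, and this \<open>c\<close> is the preimage of \<open>t\<close>.\<close>
  define c where "c = t ^ (2 ^ e)"
  have "2 ^ e * 2 ^ (e + 1) = q"
    unfolding q power_add[symmetric] by (simp add: mult_2)
  then have c: "suz_theta e c = t"
    unfolding c_def suz_theta_def power_mult[symmetric] by (simp only: power_q)
  define g where "g = suz_T ** suz_S e 0 c"
  have "suz_T \<otimes>\<^bsub>GL4\<^esub> suz_S e 0 c \<in> carrier G"
    unfolding G_def suzuki_group_def by (auto intro!: generate.eng intro: generate.incl)
  then have "g \<in> carrier G"
    by (simp add: g_def GL4_def)
  have trace_g: "trace4 g = t"
    by (simp add: trace4_def g_def suz_T_def suz_S_def matrix_matrix_mult_def sum_4 c)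
  then have trace_ac: "trace4 (ac_matrix g) = \<tau>"
    by (simp add: trace4_ac_matrix t)
  have "trace4 g \<noteq> 0"
    using trace_g t \<open>\<tau> \<noteq> 0\<close> by auto
  obtain v where v: "ac_matrix g *v v = \<alpha> *s v" "v \<noteq> 0"
    using suzuki_matrix_has_eigenvector[OF char_ac suzuki_matrix_ac_matrix[OF suzuki_matrix_if_in_G[OF \<open>g \<in> carrier G\<close>]]]
      trace_ac \<open>\<tau> \<noteq> 0\<close> \<tau>(2) r by metis
  have "g [^]\<^bsub>G\<^esub> n = \<one>\<^bsub>G\<^esub> \<longleftrightarrow> N dvd n" for n :: nat
  proof
    assume "g [^]\<^bsub>G\<^esub> n = \<one>\<^bsub>G\<^esub>"
    then have "\<alpha> ^ n *s v = 1 *s v"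
      using pow_eigenvector[OF v(1), of n] by simp
    then show "N dvd n"
      using v(2) vec.scale_cancel_right \<alpha> by blast
  next
    assume "N dvd n"
    then have "\<alpha> ^ n = 1"
      by (simp only: \<alpha>)
    then have "ac_matrix (g [^]\<^bsub>G\<^esub> n) *v v = v"
      using pow_eigenvector[OF v(1), of n] by simp
    moreover have "g \<otimes>\<^bsub>G\<^esub> g [^]\<^bsub>G\<^esub> n = g [^]\<^bsub>G\<^esub> n \<otimes>\<^bsub>G\<^esub> g"
      using \<open>g \<in> carrier G\<close> by (metis nat_pow_Suc nat_pow_Suc2)
    ultimately show "g [^]\<^bsub>G\<^esub> n = \<one>\<^bsub>G\<^esub>"
      using commuting_fixing_eigenvector_eq_one[OF \<open>g \<in> carrier G\<close> \<open>trace4 g \<noteq> 0\<close> v]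
        nat_pow_closed[OF \<open>g \<in> carrier G\<close>] by blast
  qed
  then show ?thesis
    using ord_unique[OF \<open>g \<in> carrier G\<close>] \<open>g \<in> carrier G\<close> by blast
qed

text \<open>
  All three numbers are odd, \<open>(q + r + 1) (q - r + 1) = (q - 1) (q + 1) + 2\<close>, and the two factors on the
  left differ by \<open>2 r\<close>, a power of 2.
\<close>

lemma orders_coprime:
  assumes M: "M \<in> {q - 1, q + r + 1, q - r + 1}" and N: "N \<in> {q - 1, q + r + 1, q - r + 1}" and "M \<noteq> N"
  shows "coprime M N"
proof -
  have rq: "r * r = 2 * q" "r \<le> q" "q > 0"
    using suz_parameters[of r e q] r q by simp_all
  have pow2: "coprime d 2 \<Longrightarrow> d dvd 2 ^ k \<Longrightarrow> d = 1" for d k :: nat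
    by (metis coprime_absorb_left coprime_power_right_iff nat_dvd_1_iff_1 power_0)
  have two: "d = 1" if d: "d dvd (q - 1)" "d dvd (q + r + 1) * (q - r + 1)" for d
  proof -
    have "(q + r + 1) * (q - r + 1) + r * r = q * q + 2 * q + 1"
      using \<open>r \<le> q\<close> by (auto simp: algebra_simps dest!: le_Suc_ex)
    then have "(q + r + 1) * (q - r + 1) = (q - 1) * (q + 1) + 2"
      using rq by (cases q) (auto simp: algebra_simps)
    then have "d dvd 2"
      using d by (metis dvd_add_right_iff dvd_mult2)
    moreover have "coprime d 2"
      using orders_odd[of "q - 1"] d(1) by (metis coprime_right_2_iff_odd dvd_trans insertI1)
    ultimately show ?thesis
      using pow2[of d 1] by simp
  qed
  have three: "d = 1" if d: "d dvd (q + r + 1)" "d dvd (q - r + 1)" for d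
  proof -
    have "q + r + 1 = (q - r + 1) + 2 * r"
      using rq by simp
    then have "d dvd 2 * r"
      using d by (metis dvd_add_right_iff)
    then have "d dvd 2 ^ (e + 2)"
      unfolding r by simp
    moreover have "coprime d 2"
      using orders_odd[of "q - r + 1"] d(2) by (metis coprime_right_2_iff_odd dvd_trans insertI1 insertI2)
    ultimately show ?thesis
      using pow2 by blast
  qed
  have "coprime (q - 1) (q + r + 1)" "coprime (q - 1) (q - r + 1)" "coprime (q + r + 1) (q - r + 1)"
    using two three by (auto intro!: coprimeI simp del: One_nat_def)
  then show ?thesis
    using M N \<open>M \<noteq> N\<close> by (auto simp: coprime_commute simp del: One_nat_def)
qed

theorem chordal_iff:
  assumes "e \<ge> 1"
  shows "chordal (power_graph G) \<longleftrightarrow>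
    (\<forall>n\<in>{q - 1, q + r + 1, q - r + 1}. primepow_or_prime_times_primepow n)"
proof
  assume chordal: "chordal (power_graph G)"
  show "\<forall>n\<in>{q - 1, q + r + 1, q - r + 1}. primepow_or_prime_times_primepow n"
  proof
    fix n
    assume n: "n \<in> {q - 1, q + r + 1, q - r + 1}"
    have "r > 0" "q = r * 2 ^ e"
      unfolding q r power_add[symmetric] by (simp_all add: mult_2)
    moreover have "(2::nat) ^ 1 \<le> 2 ^ e"
      using assms by (rule power_increasing) simp
    ultimately have "2 * r \<le> q" "r \<ge> 2"
      using assms r by (simp_all add: mult.commute)
    then have "n > 1"
      using n by auto
    then obtain x where "x \<in> carrier G" "ord x = n"
      using exists_element_of_order[OF n] by blast
    then show "primepow_or_prime_times_primepow n"
      using not_chordal_if_ord[OF finite_G] chordal \<open>n > 1\<close> by blast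
  qed
next
  assume form: "\<forall>n\<in>{q - 1, q + r + 1, q - r + 1}. primepow_or_prime_times_primepow n"
  show "chordal (power_graph G)"
  proof (rule chordal_power_graph_if[OF finite_G, of "{q - 1, q + r + 1, q - r + 1}"])
    show "x [^]\<^bsub>G\<^esub> (4::nat) = \<one>\<^bsub>G\<^esub> \<or> (\<exists>N\<in>{q - 1, q + r + 1, q - r + 1}. x [^]\<^bsub>G\<^esub> N = \<one>\<^bsub>G\<^esub>)"
      if "x \<in> carrier G" for x
      using pow4_if_trace_0[OF that] pow_eq_one_if_trace_nonzero[OF that] by blast
    show "odd N" if "N \<in> {q - 1, q + r + 1, q - r + 1}" for N
      using that by (rule orders_odd)
    show "coprime M N" if "M \<in> {q - 1, q + r + 1, q - r + 1}"
      "N \<in> {q - 1, q + r + 1, q - r + 1}" "M \<noteq> N" for M N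
      using that by (rule orders_coprime)
    show "primepow_or_prime_times_primepow N" if "N \<in> {q - 1, q + r + 1, q - r + 1}" for N
      using form that by blast
  qed (fact commute_trans power_of_if_ord_dvd)+
qed

end

theorem theorem5p5:
  fixes e q r :: nat
  assumes "e \<ge> 1"
    and "q = 2 ^ (2 * e + 1)"
    and "real r = sqrt (2 * real q)"
    and "CARD('a::{field,finite}) = q"
  shows "chordal (power_graph (suzuki_group e :: ('a ^ 4 ^ 4) monoid)) \<longleftrightarrow>
    (\<forall>n \<in> {q - 1, q + r + 1, q - r + 1}. primepow_or_prime_times_primepow n)"
proof -
  have "r = 2 ^ (e + 1)"
  proof -
    have "2 * q = (2 ^ (e + 1))\<^sup>2"
      using suz_parameters(1)[of "2 ^ Suc e" e q, OF refl assms(2)]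
      by (simp only: power2_eq_square Suc_eq_plus1)
    then have "2 * real q = (real (2 ^ (e + 1)))\<^sup>2"
      by (metis of_nat_mult of_nat_numeral of_nat_power)
    then have "real r = real (2 ^ (e + 1))"
      unfolding assms(3) by (simp only: real_sqrt_abs abs_of_nat)
    then show ?thesis
      by (simp only: of_nat_eq_iff)
  qed
  then interpret suzuki e q r "suzuki_group e :: ('a ^ 4 ^ 4) monoid"
    using assms(2,4) by unfold_locales auto
  show ?thesis
    using chordal_iff[OF assms(1)] .
qed

end
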